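(* Consider a block circulant MPC problem of order $n$ with horizon $T$ (as in the context) and its reformulation, obtained by eliminating the states, as the QP $$\min\ \tfrac12z^TJz+q^Tz\quad\text{s.t. } Kz-v=0,\ \ \underline v\le v\le\bar v$$ in the variables $z=(u_0,\dots,u_{T-1})$ and $v=(y_0,\dots,y_{T-1})$, with $J,K,q,\underline v,\bar v$ as given in the context. This QP is a constrained block circulant QP of order $n$ with $N_z=T$, $N_v=Tp$, $J_{kj}\in\mathcal{BC}(n,n_u,n_u)$ and $K_{wj}\in\mathcal{BC}(n,n_y,n_u)$ for all $k,j=1,\dots,T$ and $w=1,\dots,Tp$.
   Context: $\mathcal{BC}(n,p,m)\subseteq\mathbb R^{np\times nm}$ is the set of real block circulant matrices: $n\times n$ block matrices with $p\times m$ blocks whose $(r,s)$ block is $b_{(s-r)\bmod n}$ for some $b_0,\dots,b_{n-1}\in\mathbb R^{p\times m}$. Block circulant MPC problem of order $n$: the problem $$\min \sum_{k=0}^{T-1}\left(x_k^TQx_k+u_k^TRu_k\right)+x_T^TPx_T\quad\text{s.t. } x_{k+1}=Ax_k+Bu_k,\; x_0=x(t),\; y_k=Cx_k+Du_k,\; \underline y\le y_k\le\bar y,\; k=0,\dots,T-1,$$ with $x_k\in\mathbb R^{nn_x}$, $u_k\in\mathbb R^{nn_u}$, $y_k\in\mathbb R^{pnn_y}$, $p$ a positive integer, where $C$ and $D$ are partitioned as vertical stacks of $p$ blocks $C_1,\dots,C_p$ and $D_1,\dots,D_p$, and $A,Q\in\mathcal{BC}(n,n_x,n_x)$, $B\in\mathcal{BC}(n,n_x,n_u)$,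 $R\in\mathcal{BC}(n,n_u,n_u)$, $C_i\in\mathcal{BC}(n,n_y,n_x)$, $D_i\in\mathcal{BC}(n,n_y,n_u)$ for $i=1,\dots,p$. Standing assumptions: $R=R^T\succ0$, $Q=Q^T\succeq0$, $(A,B)$ is controllable, $(A,Q^{1/2})$ is observable, and $P=P^T\succ0$ solves the discrete-time algebraic Riccati equation $A^TPA-A^TPB(B^TPB+R)^{-1}B^TPA+Q=P$. Condensed QP data: writing the dynamics as $X=Gz+Hx_0$ with $X=(x_0,\dots,x_T)$, $$G=\begin{bmatrix}0&\cdots& & 0\\ B& & & \\ AB&B& & \\ \vdots& &\ddots& \\ A^{T-1}B&A^{T-2}B&\cdots&B\end{bmatrix},\qquad H=\begin{bmatrix} I \\ A \\ \vdots \\ A^T \end{bmatrix}$$ (where $A^T$ in the last block of $H$ is the $T$-th power of $A$), and $$J=G^{\top}\big((I_T\otimes Q)\oplus P\big)G+(I_T\otimes R),\qquad K=[\,I_T\otimes C\mid 0\,]\,G+(I_T\otimes D),$$ $$q=G^{\top}\big((I_T\otimes Q)\oplus P\big)Hx_0,\quad \underline v=(\mathbf 1_T\otimes\underline y)-[\,I_T\otimes C\mid0\,]Hx_0,\quad \bar v=(\mathbf 1_T\otimes\bar y)-[\,I_T\otimes C\mid0\,]Hx_0,$$ where $\oplus$ is block diagonal concatenation, $\otimes$ the Kronecker product and $\mathbf 1_T$ the all-ones vector of length $T$. (Here $v$ is understood with the contribution of $x_0$ to $y_k$ moved into the bounds.) Constrained block circulant QP (CBCQP) of order $n$: a real QP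 of the form $\min\frac12z^TJz+q^Tz$ s.t. $Kz-v=0$, $\underline v\le v\le\bar v$, for which $z$ and $v$ can be partitioned into $N_z$ and $N_v$ segments, of lengths $nl_z^1,\dots,nl_z^{N_z}$ and $nl_v^1,\dots,nl_v^{N_v}$, such that in the induced partitions $J=(J_{kj})$, $K=(K_{wj})$ one has $J_{kj}\in\mathcal{BC}(n,l_z^k,l_z^j)$, $K_{wj}\in\mathcal{BC}(n,l_v^w,l_z^j)$ for $k,j=1,\dots,N_z$, $w=1,\dots,N_v$. *)

theory Defs
  imports
    "Jordan_Normal_Form.Gauss_Jordan_Elimination"
    "Jordan_Normal_Form.DL_Submatrix"
    Complex_Main
begin

definition block_mat ::
  "nat \<Rightarrow> nat \<Rightarrow> nat \<Rightarrow> nat \<Rightarrow> (nat \<Rightarrow> nat \<Rightarrow> 'a mat) \<Rightarrow> 'a mat" where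
  "block_mat br bc p m F =
     mat (br * p) (bc * m) (\<lambda>(i, j). F (i div p) (j div m) $$ (i mod p, j mod m))"

definition kron_mat :: "'a :: times mat \<Rightarrow> 'a mat \<Rightarrow> 'a mat" where
  "kron_mat A B = block_mat (dim_row A) (dim_col A) (dim_row B) (dim_col B)
     (\<lambda>r s. A $$ (r, s) \<cdot>\<^sub>m B)"

definition kron_vec :: "'a :: times vec \<Rightarrow> 'a vec \<Rightarrow> 'a vec" where
  "kron_vec u v = vec (dim_vec u * dim_vec v) (\<lambda>i. u $ (i div dim_vec v) * v $ (i mod dim_vec v))"

text \<open>Horizontal concatenation, the column analogue of the library's \<^const>\<open>append_rows\<close>.\<close>

definition append_columns :: "'a :: zero mat \<Rightarrow> 'a mat \<Rightarrow> 'a mat" where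
  "append_columns A B = four_block_mat A B (0\<^sub>m 0 (dim_col A)) (0\<^sub>m 0 (dim_col B))"

definition block_circulant :: "nat \<Rightarrow> nat \<Rightarrow> nat \<Rightarrow> real mat set" where
  "block_circulant n p m =
     {M. \<exists>b. (\<forall>i<n. b i \<in> carrier_mat p m) \<and>
             M = block_mat n n p m (\<lambda>r s. b (nat ((int s - int r) mod int n)))}"

text \<open>The index range of the \<open>k\<close>-th segment (counting from 0) when consecutive segments have
  lengths \<open>n * ls ! 0\<close>, \<open>n * ls ! 1\<close>, \<open>\<dots>\<close>.\<close>

definition segment :: "nat \<Rightarrow> nat list \<Rightarrow> nat \<Rightarrow> nat set" where
  "segment n ls k = {n * sum_list (take k ls) ..< n * sum_list (take (Suc k) ls)}"

text \<open>The data of the problem of minimising \<open>1/2 z\<^sup>T J z + q\<^sup>T z\<close> subject to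
  \<open>K z - v = 0\<close> and \<open>v_lo \<le> v \<le> v_hi\<close>.\<close>

record qp_data =
  qp_J :: "real mat"
  qp_q :: "real vec"
  qp_K :: "real mat"
  qp_lo :: "real vec"
  qp_hi :: "real vec"

text \<open>\<open>lz\<close> and \<open>lv\<close> list the \<open>N_z\<close> numbers \<open>l_z\<close> and the \<open>N_v\<close> numbers \<open>l_v\<close>, so that
  \<open>N_z = length lz\<close> and \<open>N_v = length lv\<close>.\<close>

definition CBCQP_partition :: "nat \<Rightarrow> nat list \<Rightarrow> nat list \<Rightarrow> qp_data \<Rightarrow> bool" where
  "CBCQP_partition n lz lv qp \<longleftrightarrow>
     (\<forall>l \<in> set lz \<union> set lv. 0 < l) \<and>
     qp_J qp \<in> carrier_mat (n * sum_list lz) (n * sum_list lz) \<and>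
     qp_q qp \<in> carrier_vec (n * sum_list lz) \<and>
     qp_K qp \<in> carrier_mat (n * sum_list lv) (n * sum_list lz) \<and>
     qp_lo qp \<in> carrier_vec (n * sum_list lv) \<and>
     qp_hi qp \<in> carrier_vec (n * sum_list lv) \<and>
     (\<forall>k < length lz. \<forall>j < length lz.
        submatrix (qp_J qp) (segment n lz k) (segment n lz j)
          \<in> block_circulant n (lz ! k) (lz ! j)) \<and>
     (\<forall>w < length lv. \<forall>j < length lz.
        submatrix (qp_K qp) (segment n lv w) (segment n lz j)
          \<in> block_circulant n (lv ! w) (lz ! j))"

definition CBCQP :: "nat \<Rightarrow> qp_data \<Rightarrow> bool" where
  "CBCQP n qp \<longleftrightarrow> 0 < n \<and> (\<exists>lz lv. CBCQP_partition n lz lv qp)"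

definition pos_def :: "real mat \<Rightarrow> bool" where
  "pos_def M \<longleftrightarrow> (\<forall>x \<in> carrier_vec (dim_col M). x \<noteq> 0\<^sub>v (dim_col M) \<longrightarrow> 0 < x \<bullet> (M *\<^sub>v x))"

definition pos_semidef :: "real mat \<Rightarrow> bool" where
  "pos_semidef M \<longleftrightarrow> (\<forall>x \<in> carrier_vec (dim_col M). 0 \<le> x \<bullet> (M *\<^sub>v x))"

primrec trajectory ::
  "real mat \<Rightarrow> real mat \<Rightarrow> real vec \<Rightarrow> (nat \<Rightarrow> real vec) \<Rightarrow> nat \<Rightarrow> real vec" where
  "trajectory A B x u 0 = x"
| "trajectory A B x u (Suc k) = A *\<^sub>v trajectory A B x u k + B *\<^sub>v u k"

definition controllable :: "real mat \<Rightarrow> real mat \<Rightarrow> bool" where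
  "controllable A B \<longleftrightarrow>
     (\<forall>x \<in> carrier_vec (dim_row A). \<forall>y \<in> carrier_vec (dim_row A).
        \<exists>u N. (\<forall>k. u k \<in> carrier_vec (dim_col B)) \<and> trajectory A B x u N = y)"

text \<open>The initial state is determined by the output of the unforced system.\<close>

definition observable :: "real mat \<Rightarrow> real mat \<Rightarrow> bool" where
  "observable A S \<longleftrightarrow>
     (\<forall>x \<in> carrier_vec (dim_col A). \<forall>y \<in> carrier_vec (dim_col A).
        (\<forall>k. S *\<^sub>v ((A ^\<^sub>m k) *\<^sub>v x) = S *\<^sub>v ((A ^\<^sub>m k) *\<^sub>v y)) \<longrightarrow> x = y)"

text \<open>\<open>S\<close> is the symmetric positive semidefinite square root of \<open>M\<close>; it is unique, and it exists
  if \<open>M\<close> is symmetric positive semidefinite.\<close>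

definition psd_sqrt :: "real mat \<Rightarrow> real mat \<Rightarrow> bool" where
  "psd_sqrt M S \<longleftrightarrow> S \<in> carrier_mat (dim_row M) (dim_row M) \<and>
     transpose_mat S = S \<and> pos_semidef S \<and> S * S = M"

text \<open>For \<open>P\<close> and \<open>R\<close> positive definite, \<open>B\<^sup>T P B + R\<close> is invertible, so that
  \<^const>\<open>mat_inverse\<close> returns its inverse.\<close>

definition solves_DARE ::
  "real mat \<Rightarrow> real mat \<Rightarrow> real mat \<Rightarrow> real mat \<Rightarrow> real mat \<Rightarrow> bool" where
  "solves_DARE A B Q R P \<longleftrightarrow>
     transpose_mat A * P * A
     - transpose_mat A * P * B * the (mat_inverse (transpose_mat B * P * B + R))
         * transpose_mat B * P * A
     + Q = P"

text \<open>The data of minimising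
  \<open>(\<Sum>k<T. x\<^sub>k\<^sup>T Q x\<^sub>k + u\<^sub>k\<^sup>T R u\<^sub>k) + x\<^sub>T\<^sup>T P x\<^sub>T\<close> subject to
  \<open>x\<^sub>k\<^sub>+\<^sub>1 = A x\<^sub>k + B u\<^sub>k\<close>, \<open>y\<^sub>k = C x\<^sub>k + D u\<^sub>k\<close> and \<open>y_lo \<le> y\<^sub>k \<le> y_hi\<close> for \<open>k < T\<close>,
  with \<open>x\<^sub>0\<close> given. No structure is imposed on \<open>P\<close>.\<close>

record mpc_data =
  mpc_T :: nat
  mpc_A :: "real mat"
  mpc_B :: "real mat"
  mpc_C :: "real mat"
  mpc_D :: "real mat"
  mpc_Q :: "real mat"
  mpc_R :: "real mat"
  mpc_P :: "real mat"
  mpc_lo :: "real vec"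
  mpc_hi :: "real vec"
  mpc_x0 :: "real vec"

definition block_circulant_MPC ::
  "nat \<Rightarrow> nat \<Rightarrow> nat \<Rightarrow> nat \<Rightarrow> nat \<Rightarrow> mpc_data \<Rightarrow> bool" where
  "block_circulant_MPC n nx nu ny p M \<longleftrightarrow>
     0 < n \<and> 0 < nx \<and> 0 < nu \<and> 0 < ny \<and> 0 < p \<and> 0 < mpc_T M \<and>
     mpc_A M \<in> block_circulant n nx nx \<and>
     mpc_B M \<in> block_circulant n nx nu \<and>
     mpc_Q M \<in> block_circulant n nx nx \<and>
     mpc_R M \<in> block_circulant n nu nu \<and>
     mpc_P M \<in> carrier_mat (n * nx) (n * nx) \<and>
     mpc_C M \<in> carrier_mat (p * (n * ny)) (n * nx) \<and>
     mpc_D M \<in> carrier_mat (p * (n * ny)) (n * nu) \<and>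
     (\<forall>i<p. submatrix (mpc_C M) (segment n (replicate p ny) i) UNIV \<in> block_circulant n ny nx) \<and>
     (\<forall>i<p. submatrix (mpc_D M) (segment n (replicate p ny) i) UNIV \<in> block_circulant n ny nu) \<and>
     mpc_lo M \<in> carrier_vec (p * (n * ny)) \<and>
     mpc_hi M \<in> carrier_vec (p * (n * ny)) \<and>
     mpc_x0 M \<in> carrier_vec (n * nx)"

definition MPC_standing_assumptions :: "mpc_data \<Rightarrow> bool" where
  "MPC_standing_assumptions M \<longleftrightarrow>
     transpose_mat (mpc_R M) = mpc_R M \<and> pos_def (mpc_R M) \<and>
     transpose_mat (mpc_Q M) = mpc_Q M \<and> pos_semidef (mpc_Q M) \<and>
     controllable (mpc_A M) (mpc_B M) \<and>
     (\<exists>S. psd_sqrt (mpc_Q M) S \<and> observable (mpc_A M) S) \<and>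
     transpose_mat (mpc_P M) = mpc_P M \<and> pos_def (mpc_P M) \<and>
     solves_DARE (mpc_A M) (mpc_B M) (mpc_Q M) (mpc_R M) (mpc_P M)"

text \<open>With \<open>z = (u\<^sub>0, \<dots>, u\<^sub>T\<^sub>-\<^sub>1)\<close>, the states are \<open>(x\<^sub>0, \<dots>, x\<^sub>T) = G z + H x\<^sub>0\<close>.\<close>

definition condensed_G :: "mpc_data \<Rightarrow> real mat" where
  "condensed_G M =
     block_mat (Suc (mpc_T M)) (mpc_T M) (dim_row (mpc_B M)) (dim_col (mpc_B M))
       (\<lambda>k j. if j < k then mpc_A M ^\<^sub>m (k - 1 - j) * mpc_B M
              else 0\<^sub>m (dim_row (mpc_B M)) (dim_col (mpc_B M)))"

definition condensed_H :: "mpc_data \<Rightarrow> real mat" where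
  "condensed_H M =
     block_mat (Suc (mpc_T M)) 1 (dim_row (mpc_A M)) (dim_col (mpc_A M)) (\<lambda>k _. mpc_A M ^\<^sub>m k)"

definition state_weight :: "mpc_data \<Rightarrow> real mat" where
  "state_weight M = diag_block_mat [kron_mat (1\<^sub>m (mpc_T M)) (mpc_Q M), mpc_P M]"

definition output_map :: "mpc_data \<Rightarrow> real mat" where
  "output_map M = append_columns (kron_mat (1\<^sub>m (mpc_T M)) (mpc_C M))
     (0\<^sub>m (mpc_T M * dim_row (mpc_C M)) (dim_col (mpc_C M)))"

definition condensed_QP :: "mpc_data \<Rightarrow> qp_data" where
  "condensed_QP M = (let
     G = condensed_G M; H = condensed_H M; W = state_weight M; Y = output_map M;
     I\<^sub>T = 1\<^sub>m (mpc_T M); ones = vec (mpc_T M) (\<lambda>_. 1)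
   in \<lparr> qp_J = transpose_mat G * W * G + kron_mat I\<^sub>T (mpc_R M),
        qp_q = (transpose_mat G * W * H) *\<^sub>v mpc_x0 M,
        qp_K = Y * G + kron_mat I\<^sub>T (mpc_D M),
        qp_lo = kron_vec ones (mpc_lo M) - (Y * H) *\<^sub>v mpc_x0 M,
        qp_hi = kron_vec ones (mpc_hi M) - (Y * H) *\<^sub>v mpc_x0 M \<rparr>)"

end

theory Submission
  imports
    Defs
    "Jordan_Normal_Form.Determinant"
    "HOL-Analysis.Function_Topology"
    "HOL-Number_Theory.Cong"
begin

text \<open>The condensed matrices are built from the problem data by powers, products, sums, transposes and
  Kronecker products with the identity. Block circulance is a symmetry: a matrix is block circulant
  if and only if it is unchanged when the blocks of its rows and of its columns are cyclically
  shifted by one (\<open>block_circulant_iff_shift_invariant\<close>). For a matrix partitioned into several segments, apply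
  the shift in all segments simultaneously. Invariance under a simultaneous permutation of rows and columns
  survives all the operations above, so the whole of \<open>J\<close> and \<open>K\<close> is invariant; restricted to a
  pair of segments, this says that each block of the partition is block circulant
  (\<open>submatrix_segment_block_circulant\<close>).

  What remains is the terminal weight \<open>P\<close>, which enters \<open>J\<close> and is characterised only by the Riccati
  equation. The shift maps \<open>A\<close>, \<open>B\<close>, \<open>Q\<close>, \<open>R\<close> to themselves, so it maps \<open>P\<close> to another positive
  definite solution of the same equation, and \<open>P\<close> is invariant because such a solution is unique
  (\<open>riccati_unique\<close>). For uniqueness, let \<open>P1\<close> and \<open>P2\<close> be two solutions and \<open>z\<close> a vector at which the ratio
  \<open>z\<^sup>T P2 z / z\<^sup>T P1 z\<close> is maximal. If the maximum exceeded 1, then the stage cost would vanish at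
  \<open>z\<close> and the maximum would be attained at \<open>A z\<close> as well (\<open>riccati_excess_orbit\<close>). By induction the orbit of \<open>z\<close> under
  \<open>A\<close> would have zero output, which contradicts observability. So the form of \<open>P2\<close> is at most that of
  \<open>P1\<close>, and the reverse holds by exchanging them.\<close>

section \<open>Quadratic forms\<close>

lemma mult_mat_vec_zero:
  "M \<in> carrier_mat a b \<Longrightarrow> M *\<^sub>v 0\<^sub>v b = (0\<^sub>v a :: real vec)"
  by (intro eq_vecI) auto

lemma symmetric_form_commute:
  fixes M :: "real mat"
  assumes M: "M \<in> carrier_mat d d" and sym: "transpose_mat M = M"
    and x: "x \<in> carrier_vec d" and y: "y \<in> carrier_vec d"
  shows "x \<bullet> (M *\<^sub>v y) = y \<bullet> (M *\<^sub>v x)"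
  using transpose_vec_mult_scalar[OF M y x] sym comm_scalar_prod[of "M *\<^sub>v x" d y] M x y
  by simp

lemma symmetric_form_add:
  fixes M :: "real mat"
  assumes M: "M \<in> carrier_mat d d" and sym: "transpose_mat M = M"
    and x: "x \<in> carrier_vec d" and y: "y \<in> carrier_vec d"
  shows "(x + y) \<bullet> (M *\<^sub>v (x + y)) = x \<bullet> (M *\<^sub>v x) + 2 * (x \<bullet> (M *\<^sub>v y)) + y \<bullet> (M *\<^sub>v y)"
proof -
  have c: "M *\<^sub>v x \<in> carrier_vec d" "M *\<^sub>v y \<in> carrier_vec d" using M x y by auto
  have "M *\<^sub>v (x + y) = M *\<^sub>v x + M *\<^sub>v y" by (rule mult_add_distrib_mat_vec[OF M x y])
  then show ?thesis
    using symmetric_form_commute[OF M sym x y] c x y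
    by (simp add: add_scalar_prod_distrib[of _ d] scalar_prod_add_distrib[of _ d])
qed

text \<open>Polarisation: expanding the form at \<open>e\<^sub>i + e\<^sub>j\<close> recovers the entry \<open>(i, j)\<close>.\<close>

lemma symmetric_mat_eqI:
  fixes M N :: "real mat"
  assumes M: "M \<in> carrier_mat d d" "transpose_mat M = M"
    and N: "N \<in> carrier_mat d d" "transpose_mat N = N"
    and eq: "\<And>x. x \<in> carrier_vec d \<Longrightarrow> x \<bullet> (M *\<^sub>v x) = x \<bullet> (N *\<^sub>v x)"
  shows "M = N"
proof (rule eq_matI)
  fix i j assume "i < dim_row N" "j < dim_col N"
  then have ij: "i < d" "j < d" using N by auto
  let ?x = "unit_vec d i :: real vec" and ?y = "unit_vec d j :: real vec"
  have c: "?x \<in> carrier_vec d" "?y \<in> carrier_vec d" by auto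
  have entry: "?x \<bullet> (L *\<^sub>v ?y) = L $$ (i, j)" if "L \<in> carrier_mat d d" for L
    using that ij by simp
  have "?x \<bullet> (M *\<^sub>v ?y) = ?x \<bullet> (N *\<^sub>v ?y)"
    using symmetric_form_add[OF M c] symmetric_form_add[OF N c] eq[of "?x + ?y"] eq[OF c(1)] eq[OF c(2)]
    by (simp del: scalar_prod_left_unit)
  then show "M $$ (i, j) = N $$ (i, j)" by (simp only: entry[OF M(1)] entry[OF N(1)])
qed (use M N in auto)

lemma pos_def_form_pos:
  assumes "pos_def M" "M \<in> carrier_mat d d" "x \<in> carrier_vec d" "x \<noteq> 0\<^sub>v d"
  shows "0 < x \<bullet> (M *\<^sub>v x)"
  using assms unfolding pos_def_def by auto

lemma pos_def_form_nonneg: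
  assumes "pos_def M" "M \<in> carrier_mat d d" "x \<in> carrier_vec d"
  shows "0 \<le> x \<bullet> (M *\<^sub>v x)"
proof (cases "x = 0\<^sub>v d")
  case True
  then show ?thesis using assms by simp
qed (use pos_def_form_pos[OF assms] in simp)

lemma pos_def_form_eq_0D:
  assumes "pos_def M" "M \<in> carrier_mat d d" "x \<in> carrier_vec d" "x \<bullet> (M *\<^sub>v x) = 0"
  shows "x = 0\<^sub>v d"
  using pos_def_form_pos[OF assms(1-3)] assms(4) by fastforce

text \<open>Vectors of the matrix library carry their dimension as a value and have no topology.
  Extending the coordinates by zero embeds them into the function space \<open>nat \<Rightarrow> real\<close>, whose
  product topology makes the cube compact (Tychonoff); the sphere is closed in it.\<close>

lemma compact_unit_sphere_coordinates:
  "compact {f :: nat \<Rightarrow> real. (\<forall>i\<ge>d. f i = 0) \<and> (\<Sum>i<d. (f i)\<^sup>2) = 1}" (is "compact ?S")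
proof -
  let ?C = "PiE UNIV (\<lambda>i::nat. if i < d then {-1..1::real} else {0})"
  have "compactin (product_topology (\<lambda>i::nat. euclidean::real topology) UNIV) ?C"
    unfolding compactin_PiE by auto
  then have C: "compact ?C" unfolding euclidean_product_topology by simp
  have cl: "closed {f :: nat \<Rightarrow> real. (\<Sum>i<d. (f i)\<^sup>2) = 1}"
    by (intro closed_Collect_eq continuous_intros continuous_on_product_coordinates)
  have "?S = ?C \<inter> {f. (\<Sum>i<d. (f i)\<^sup>2) = 1}"
  proof (intro equalityI subsetI)
    fix f assume f: "f \<in> ?S"
    have "f i \<in> {-1..1}" if i: "i < d" for i
    proof -
      have "(f i)\<^sup>2 \<le> (\<Sum>i<d. (f i)\<^sup>2)" by (rule member_le_sum) (use i in auto)
      then have "(f i)\<^sup>2 \<le> 1" using f by simp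
      then show ?thesis by (simp add: abs_square_le_1 abs_le_iff)
    qed
    then show "f \<in> ?C \<inter> {f. (\<Sum>i<d. (f i)\<^sup>2) = 1}" using f by auto
  next
    fix f assume f: "f \<in> ?C \<inter> {f. (\<Sum>i<d. (f i)\<^sup>2) = 1}"
    have "f i = 0" if "i \<ge> d" for i
      using f that PiE_mem[of f UNIV "\<lambda>i. if i < d then {-1..1} else {0}" i] by auto
    then show "f \<in> ?S" using f by auto
  qed
  then show ?thesis using compact_Int_closed[OF C cl] by simp
qed

lemma quadratic_form_smult:
  fixes M :: "real mat"
  assumes "M \<in> carrier_mat d d" "x \<in> carrier_vec d"
  shows "(c \<cdot>\<^sub>v x) \<bullet> (M *\<^sub>v (c \<cdot>\<^sub>v x)) = c\<^sup>2 * (x \<bullet> (M *\<^sub>v x))"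
  using assms by (simp add: mult_mat_vec[of _ d d] power2_eq_square)

text \<open>The ratio \<open>y\<^sup>T N y / y\<^sup>T P y\<close> is homogeneous of degree 0, so its maximum over the compact unit
  sphere is a maximum over all nonzero vectors. For symmetric matrices the maximal value \<open>\<rho>\<close> is the largest generalised
  eigenvalue of \<open>(N, P)\<close>; getting it by compactness avoids the spectral theorem.\<close>

lemma form_ratio_attains_max:
  fixes N P :: "real mat"
  assumes d: "0 < d" and N: "N \<in> carrier_mat d d" and P: "P \<in> carrier_mat d d" "pos_def P"
  obtains \<rho> x where "x \<in> carrier_vec d" "x \<noteq> 0\<^sub>v d"
    "x \<bullet> (N *\<^sub>v x) = \<rho> * (x \<bullet> (P *\<^sub>v x))"
    "\<And>y. y \<in> carrier_vec d \<Longrightarrow> y \<bullet> (N *\<^sub>v y) \<le> \<rho> * (y \<bullet> (P *\<^sub>v y))"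
proof -
  define S where "S = {f :: nat \<Rightarrow> real. (\<forall>i\<ge>d. f i = 0) \<and> (\<Sum>i<d. (f i)\<^sup>2) = 1}"
  define ratio where "ratio y = (y \<bullet> (N *\<^sub>v y)) / (y \<bullet> (P *\<^sub>v y))" for y
  have nz: "vec d f \<noteq> 0\<^sub>v d" if "f \<in> S" for f
  proof
    assume z: "vec d f = 0\<^sub>v d"
    have "f i = 0" if "i < d" for i using arg_cong[OF z, of "\<lambda>v. v $ i"] that by simp
    then show False using \<open>f \<in> S\<close> unfolding S_def by simp
  qed
  have Ppos: "0 < y \<bullet> (P *\<^sub>v y)" if "y \<in> carrier_vec d" "y \<noteq> 0\<^sub>v d" for y
    by (rule pos_def_form_pos[OF P(2,1) that])
  have cont: "continuous_on S (\<lambda>f. vec d f \<bullet> (L *\<^sub>v vec d f))" if L: "L \<in> carrier_mat d d" for L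
  proof -
    have "vec d f \<bullet> (L *\<^sub>v vec d f) = (\<Sum>i<d. f i * (\<Sum>j<d. L $$ (i, j) * f j))" for f
      using L by (simp add: scalar_prod_def lessThan_atLeast0)
    moreover have "continuous_on S (\<lambda>f. f i)" for i
      by (rule continuous_on_subset[OF continuous_on_product_coordinates]) simp
    ultimately show ?thesis by (simp only:) (intro continuous_intros)
  qed
  have "compact S" unfolding S_def by (rule compact_unit_sphere_coordinates)
  moreover have "(\<lambda>i. if i = 0 then 1 else 0) \<in> S"
    using d unfolding S_def by (auto simp: if_distrib[of "\<lambda>x. x\<^sup>2"] sum.delta cong: if_cong)
  then have "S \<noteq> {}" by auto
  moreover have "continuous_on S (\<lambda>f. ratio (vec d f))"
    unfolding ratio_def
    using Ppos[OF vec_carrier nz] by (intro continuous_on_divide cont N P) (auto simp: less_imp_neq[symmetric])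
  ultimately obtain g where g: "g \<in> S" and max: "\<And>f. f \<in> S \<Longrightarrow> ratio (vec d f) \<le> ratio (vec d g)"
    using continuous_attains_sup by metis
  let ?x = "vec d g"
  have "y \<bullet> (N *\<^sub>v y) \<le> ratio ?x * (y \<bullet> (P *\<^sub>v y))" if y: "y \<in> carrier_vec d" for y
  proof (cases "y = 0\<^sub>v d")
    case True
    then show ?thesis using N P by simp
  next
    case False
    let ?s = "\<Sum>i<d. (y $ i)\<^sup>2"
    obtain i where "i < d" "y $ i \<noteq> 0" using False y by (metis carrier_vecD eq_vecI index_zero_vec)
    then have s: "?s > 0" by (intro sum_pos2[of _ i]) auto
    define c where "c = 1 / sqrt ?s"
    have c: "c \<noteq> 0" "c\<^sup>2 = 1 / ?s" using s by (auto simp: c_def power_divide)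
    let ?f = "\<lambda>i. if i < d then c * y $ i else 0"
    have "(\<Sum>i<d. (?f i)\<^sup>2) = c\<^sup>2 * ?s" by (simp add: power_mult_distrib sum_distrib_left)
    then have "?f \<in> S" using c s unfolding S_def by simp
    moreover have "vec d ?f = c \<cdot>\<^sub>v y" using y by (intro eq_vecI) auto
    ultimately have "ratio (c \<cdot>\<^sub>v y) \<le> ratio ?x" using max by metis
    moreover have "ratio (c \<cdot>\<^sub>v y) = ratio y"
      unfolding ratio_def quadratic_form_smult[OF N y] quadratic_form_smult[OF P(1) y] using c(1) by simp
    ultimately show ?thesis using Ppos[OF y False] by (simp add: ratio_def pos_divide_le_eq)
  qed
  moreover have "?x \<bullet> (N *\<^sub>v ?x) = ratio ?x * (?x \<bullet> (P *\<^sub>v ?x))"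
    using Ppos[of ?x] nz[OF g] by (simp add: ratio_def)
  ultimately show thesis using that nz[OF g] by (metis vec_carrier)
qed

section \<open>Uniqueness of the positive definite Riccati solution\<close>

text \<open>A linear system \<open>x' = A x + B u\<close> with stage cost \<open>x\<^sup>T Q x + u\<^sup>T R u\<close>.\<close>

locale lq_problem =
  fixes d m :: nat and A B Q R :: "real mat"
  assumes A: "A \<in> carrier_mat d d" and B: "B \<in> carrier_mat d m"
    and Q: "Q \<in> carrier_mat d d" and R: "R \<in> carrier_mat m m"
    and Q_psd: "pos_semidef Q" and R_sym: "transpose_mat R = R" and R_pos: "pos_def R"
begin

definition input_weight :: "real mat \<Rightarrow> real mat" where
  "input_weight P = transpose_mat B * P * B + R"

text \<open>The Riccati equation with the optimal gain \<open>K = (B\<^sup>T P B + R)\<^sup>-\<^sup>1 B\<^sup>T P A\<close> as a second unknown.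
  Without an inverse both equations are polynomial, hence are carried over entrywise by
  permutations of the coordinates.\<close>

definition riccati :: "real mat \<Rightarrow> real mat \<Rightarrow> bool" where
  "riccati P K \<longleftrightarrow> P \<in> carrier_mat d d \<and> transpose_mat P = P \<and> pos_def P \<and>
     K \<in> carrier_mat m d \<and> input_weight P * K = transpose_mat B * P * A \<and>
     transpose_mat A * P * A - transpose_mat A * P * B * K + Q = P"

lemma input_weight_carrier: "P \<in> carrier_mat d d \<Longrightarrow> input_weight P \<in> carrier_mat m m"
  using B R unfolding input_weight_def by auto

lemma input_weight_symmetric:
  assumes "P \<in> carrier_mat d d" "transpose_mat P = P"
  shows "transpose_mat (input_weight P) = input_weight P"
proof -
  have "transpose_mat (transpose_mat B * P * B) = transpose_mat B * P * B"
    using assms B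
      transpose_mult[of "transpose_mat B * P" m d B m] transpose_mult[of "transpose_mat B" m d P d]
      assoc_mult_mat[of "transpose_mat B" m d P d B m]
    by simp
  then show ?thesis
    using assms B R R_sym unfolding input_weight_def by (simp add: transpose_add[of _ m m])
qed

lemma input_weight_form:
  assumes P: "P \<in> carrier_mat d d" and u: "u \<in> carrier_vec m" and w: "w \<in> carrier_vec m"
  shows "w \<bullet> (input_weight P *\<^sub>v u) = (B *\<^sub>v w) \<bullet> (P *\<^sub>v (B *\<^sub>v u)) + w \<bullet> (R *\<^sub>v u)"
proof -
  have c: "B *\<^sub>v u \<in> carrier_vec d" "B *\<^sub>v w \<in> carrier_vec d" "P *\<^sub>v (B *\<^sub>v u) \<in> carrier_vec d"
    using B P u w by auto
  have "input_weight P *\<^sub>v u = transpose_mat B *\<^sub>v (P *\<^sub>v (B *\<^sub>v u)) + R *\<^sub>v u"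
    unfolding input_weight_def using B P R u c
    by (simp add: add_mult_distrib_mat_vec[of _ m m] assoc_mult_mat_vec[of _ m d _ m]
        assoc_mult_mat_vec[of _ m d _ d])
  moreover have "w \<bullet> (transpose_mat B *\<^sub>v (P *\<^sub>v (B *\<^sub>v u))) = (B *\<^sub>v w) \<bullet> (P *\<^sub>v (B *\<^sub>v u))"
    using transpose_vec_mult_scalar[OF B w c(3)] c B w
    by (simp add: comm_scalar_prod[of w m] comm_scalar_prod[of "B *\<^sub>v w" d])
  ultimately show ?thesis
    using B R P u w by (simp add: scalar_prod_add_distrib[of _ m])
qed

lemma input_weight_pos_def:
  assumes P: "P \<in> carrier_mat d d" "pos_def P"
  shows "pos_def (input_weight P)"
  unfolding pos_def_def
proof (intro ballI impI)
  fix u :: "real vec"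
  assume "u \<in> carrier_vec (dim_col (input_weight P))" "u \<noteq> 0\<^sub>v (dim_col (input_weight P))"
  then have u: "u \<in> carrier_vec m" "u \<noteq> 0\<^sub>v m" using input_weight_carrier[OF P(1)] by auto
  have "0 \<le> (B *\<^sub>v u) \<bullet> (P *\<^sub>v (B *\<^sub>v u))" using pos_def_form_nonneg[OF P(2,1)] B u by auto
  moreover have "0 < u \<bullet> (R *\<^sub>v u)" by (rule pos_def_form_pos[OF R_pos R u])
  ultimately show "0 < u \<bullet> (input_weight P *\<^sub>v u)"
    using input_weight_form[OF P(1) u(1) u(1)] by simp
qed

lemma input_weight_solvable:
  assumes P: "P \<in> carrier_mat d d" "pos_def P"
  obtains Z where "mat_inverse (input_weight P) = Some Z" "Z \<in> carrier_mat m m"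
    "input_weight P * Z = 1\<^sub>m m"
proof -
  note c = input_weight_carrier[OF P(1)]
  have "det (input_weight P) \<noteq> 0"
    using pos_def_form_pos[OF input_weight_pos_def[OF P] c] det_0_iff_vec_prod_zero[OF c] by fastforce
  then have "input_weight P \<in> Units (ring_mat TYPE(real) m ())"
    by (rule det_non_zero_imp_unit[OF c])
  then have "mat_inverse (input_weight P) \<noteq> None" using mat_inverse(1)[OF c, where b = "()"] by blast
  then show thesis using that mat_inverse(2)[OF c] by blast
qed

text \<open>Since \<open>P\<close> and \<open>R\<close> are positive definite, so is \<open>B\<^sup>T P B + R\<close>. Hence its computed inverse is a
  genuine one, and the gain is the product of that inverse with \<open>B\<^sup>T P A\<close>.\<close>

lemma DARE_imp_riccati:
  assumes P: "P \<in> carrier_mat d d" "transpose_mat P = P" "pos_def P"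
    and dare: "solves_DARE A B Q R P"
  obtains K where "riccati P K"
proof -
  obtain Z where inv: "mat_inverse (input_weight P) = Some Z" and Z: "Z \<in> carrier_mat m m"
    and unit: "input_weight P * Z = 1\<^sub>m m"
    using input_weight_solvable[OF P(1,3)] .
  define L where "L = transpose_mat B * P * A"
  have L: "L \<in> carrier_mat m d" using A B P unfolding L_def by auto
  have "input_weight P * (Z * L) = L"
    using assoc_mult_mat[OF input_weight_carrier[OF P(1)] Z L] unit L by simp
  moreover have "transpose_mat A * P * B * Z * transpose_mat B * P * A
      = transpose_mat A * P * B * (Z * L)"
    unfolding L_def using A B P Z
    by (simp add: assoc_mult_mat[of _ d m _ m _ d] assoc_mult_mat[of _ d m _ d _ d]
        assoc_mult_mat[of _ m m _ d _ d] assoc_mult_mat[of _ m d _ d _ d])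
  ultimately have "riccati P (Z * L)"
    using P Z L dare unfolding riccati_def solves_DARE_def input_weight_def[symmetric] inv L_def
    by auto
  then show thesis by (rule that)
qed

text \<open>Completing the square in \<open>u\<close>. It exhibits \<open>x\<^sup>T P x\<close> as the minimum over \<open>u\<close> of the stage cost
  plus \<open>x'\<^sup>T P x'\<close> at the successor state \<open>x'\<close>, attained exactly at the feedback \<open>u = - K x\<close>; the next
  two lemmas record the inequality and the case of equality.\<close>

lemma riccati_complete_square:
  assumes ric: "riccati P K" and x: "x \<in> carrier_vec d" and u: "u \<in> carrier_vec m"
  shows "x \<bullet> (Q *\<^sub>v x) + u \<bullet> (R *\<^sub>v u) + (A *\<^sub>v x + B *\<^sub>v u) \<bullet> (P *\<^sub>v (A *\<^sub>v x + B *\<^sub>v u))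
    = x \<bullet> (P *\<^sub>v x) + (u + K *\<^sub>v x) \<bullet> (input_weight P *\<^sub>v (u + K *\<^sub>v x))"
proof -
  have P: "P \<in> carrier_mat d d" "transpose_mat P = P" and K: "K \<in> carrier_mat m d"
    and gain: "input_weight P * K = transpose_mat B * P * A"
    and eq: "transpose_mat A * P * A - transpose_mat A * P * B * K + Q = P"
    using ric unfolding riccati_def by auto
  define a b w where "a = A *\<^sub>v x" and "b = B *\<^sub>v u" and "w = K *\<^sub>v x"
  have c: "a \<in> carrier_vec d" "b \<in> carrier_vec d" "w \<in> carrier_vec m" "B *\<^sub>v w \<in> carrier_vec d"
    using A B K x u unfolding a_def b_def w_def by auto
  have c2: "P *\<^sub>v a \<in> carrier_vec d" "P *\<^sub>v b \<in> carrier_vec d" "P *\<^sub>v (B *\<^sub>v w) \<in> carrier_vec d"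
    using P c by auto
  note \<Gamma> = input_weight_carrier[OF P(1)]
  have gw: "input_weight P *\<^sub>v w = transpose_mat B *\<^sub>v (P *\<^sub>v a)"
  proof -
    have "input_weight P *\<^sub>v w = (input_weight P * K) *\<^sub>v x"
      unfolding w_def using assoc_mult_mat_vec[OF \<Gamma> K x] by simp
    also have "\<dots> = transpose_mat B *\<^sub>v (P *\<^sub>v a)"
      unfolding gain a_def using A B P x
      by (simp add: assoc_mult_mat_vec[of _ m d _ d])
    finally show ?thesis .
  qed
  have adj: "v \<bullet> (transpose_mat B *\<^sub>v (P *\<^sub>v a)) = (B *\<^sub>v v) \<bullet> (P *\<^sub>v a)" if v: "v \<in> carrier_vec m" for v
    using transpose_vec_mult_scalar[OF B v c2(1)] c2 B v
    by (simp add: comm_scalar_prod[of v m] comm_scalar_prod[of "B *\<^sub>v v" d])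
  have adjA: "x \<bullet> (transpose_mat A *\<^sub>v y) = a \<bullet> y" if y: "y \<in> carrier_vec d" for y
    using transpose_vec_mult_scalar[OF A x y] A x y unfolding a_def
    by (simp add: comm_scalar_prod[of x d] comm_scalar_prod[of "A *\<^sub>v x" d])
  have square: "(u + w) \<bullet> (input_weight P *\<^sub>v (u + w))
      = u \<bullet> (R *\<^sub>v u) + b \<bullet> (P *\<^sub>v b) + 2 * (b \<bullet> (P *\<^sub>v a)) + (B *\<^sub>v w) \<bullet> (P *\<^sub>v a)"
    unfolding symmetric_form_add[OF \<Gamma> input_weight_symmetric[OF P] u c(3)] gw adj[OF u] adj[OF c(3)]
    using input_weight_form[OF P(1) u u] unfolding b_def by simp
  have "P *\<^sub>v x = transpose_mat A *\<^sub>v (P *\<^sub>v a) - transpose_mat A *\<^sub>v (P *\<^sub>v (B *\<^sub>v w)) + Q *\<^sub>v x"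
  proof -
    have c3: "transpose_mat A * P * A \<in> carrier_mat d d" "transpose_mat A * P * B * K \<in> carrier_mat d d"
      "transpose_mat A * P \<in> carrier_mat d d" "transpose_mat A * P * B \<in> carrier_mat d m"
      "transpose_mat A \<in> carrier_mat d d"
      using A B P K by auto
    have "(transpose_mat A * P * A) *\<^sub>v x = transpose_mat A *\<^sub>v (P *\<^sub>v a)"
      unfolding a_def using assoc_mult_mat_vec[OF c3(3) A x] assoc_mult_mat_vec[OF c3(5) P(1), of a]
        c(1) unfolding a_def by simp
    moreover have "(transpose_mat A * P * B * K) *\<^sub>v x = transpose_mat A *\<^sub>v (P *\<^sub>v (B *\<^sub>v w))"
      using assoc_mult_mat_vec[OF c3(4) K x] assoc_mult_mat_vec[OF c3(3) B c(3)]
        assoc_mult_mat_vec[OF c3(5) P(1) c(4)] unfolding w_def by simp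
    moreover have "(transpose_mat A * P * A - transpose_mat A * P * B * K + Q) *\<^sub>v x
        = (transpose_mat A * P * A) *\<^sub>v x - (transpose_mat A * P * B * K) *\<^sub>v x + Q *\<^sub>v x"
      using add_mult_distrib_mat_vec[of "transpose_mat A * P * A - transpose_mat A * P * B * K" d d Q x]
        minus_mult_distrib_mat_vec[OF c3(1,2) x] minus_carrier_mat[OF c3(2)] Q x by simp
    ultimately show ?thesis unfolding eq by simp
  qed
  then have "x \<bullet> (P *\<^sub>v x) = a \<bullet> (P *\<^sub>v a) - a \<bullet> (P *\<^sub>v (B *\<^sub>v w)) + x \<bullet> (Q *\<^sub>v x)"
    using A Q x c c2
    by (simp add: scalar_prod_add_distrib[of _ d] scalar_prod_minus_distrib[of _ d] adjA)
  moreover have "a \<bullet> (P *\<^sub>v (B *\<^sub>v w)) = (B *\<^sub>v w) \<bullet> (P *\<^sub>v a)"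
    by (rule symmetric_form_commute[OF P c(1,4)])
  moreover have "b \<bullet> (P *\<^sub>v a) = a \<bullet> (P *\<^sub>v b)" by (rule symmetric_form_commute[OF P c(2,1)])
  ultimately show ?thesis
    using symmetric_form_add[OF P c(1,2)] square unfolding a_def[symmetric] b_def[symmetric] w_def[symmetric]
    by simp
qed

lemma riccati_le_step_cost:
  assumes ric: "riccati P K" and x: "x \<in> carrier_vec d" and u: "u \<in> carrier_vec m"
  shows "x \<bullet> (P *\<^sub>v x)
    \<le> x \<bullet> (Q *\<^sub>v x) + u \<bullet> (R *\<^sub>v u) + (A *\<^sub>v x + B *\<^sub>v u) \<bullet> (P *\<^sub>v (A *\<^sub>v x + B *\<^sub>v u))"
proof -
  have P: "P \<in> carrier_mat d d" "pos_def P" and K: "K \<in> carrier_mat m d"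
    using ric unfolding riccati_def by auto
  have "0 \<le> (u + K *\<^sub>v x) \<bullet> (input_weight P *\<^sub>v (u + K *\<^sub>v x))"
    using pos_def_form_nonneg[OF input_weight_pos_def[OF P] input_weight_carrier[OF P(1)]] u K x
    by auto
  then show ?thesis using riccati_complete_square[OF ric x u] by simp
qed

lemma riccati_eq_feedback_cost:
  assumes ric: "riccati P K" and x: "x \<in> carrier_vec d"
  defines "u \<equiv> - (K *\<^sub>v x)"
  shows "x \<bullet> (P *\<^sub>v x)
    = x \<bullet> (Q *\<^sub>v x) + u \<bullet> (R *\<^sub>v u) + (A *\<^sub>v x + B *\<^sub>v u) \<bullet> (P *\<^sub>v (A *\<^sub>v x + B *\<^sub>v u))"
proof -
  have P: "P \<in> carrier_mat d d" and K: "K \<in> carrier_mat m d"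
    using ric unfolding riccati_def by auto
  have u: "u \<in> carrier_vec m" using K x unfolding u_def by auto
  have "u + K *\<^sub>v x = 0\<^sub>v m" using K x unfolding u_def by auto
  then have "(u + K *\<^sub>v x) \<bullet> (input_weight P *\<^sub>v (u + K *\<^sub>v x)) = 0"
    using input_weight_carrier[OF P] by simp
  then show ?thesis using riccati_complete_square[OF ric x u] by simp
qed

text \<open>Let \<open>\<rho> > 1\<close> be an upper bound of the ratio of the two value functions that is attained at \<open>x\<close>.
  Let \<open>y\<close> be the successor of \<open>x\<close> under the feedback that is optimal for \<open>P1\<close>, and \<open>s \<ge> 0\<close> the stage cost. Then
  \<open>\<rho> (s + y\<^sup>T P1 y) = \<rho> x\<^sup>T P1 x = x\<^sup>T P2 x \<le> s + y\<^sup>T P2 y \<le> s + \<rho> y\<^sup>T P1 y\<close>,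
  so \<open>(\<rho> - 1) s \<le> 0\<close>. The stage cost vanishes, and with it the state cost and, as \<open>R\<close> is positive definite, the input; moreover
  all the inequalities are equalities, so the ratio is attained at \<open>y = A x\<close> too.\<close>

lemma riccati_excess_orbit:
  assumes ric1: "riccati P1 K1" and ric2: "riccati P2 K2" and \<rho>: "\<rho> > 1"
    and bound: "\<And>y. y \<in> carrier_vec d \<Longrightarrow> y \<bullet> (P2 *\<^sub>v y) \<le> \<rho> * (y \<bullet> (P1 *\<^sub>v y))"
    and x: "x \<in> carrier_vec d" and att: "x \<bullet> (P2 *\<^sub>v x) = \<rho> * (x \<bullet> (P1 *\<^sub>v x))"
  shows "x \<bullet> (Q *\<^sub>v x) = 0" and "(A *\<^sub>v x) \<bullet> (P2 *\<^sub>v (A *\<^sub>v x)) = \<rho> * ((A *\<^sub>v x) \<bullet> (P1 *\<^sub>v (A *\<^sub>v x)))"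
proof -
  have K1: "K1 \<in> carrier_mat m d" using ric1 unfolding riccati_def by auto
  define u where "u = - (K1 *\<^sub>v x)"
  have u: "u \<in> carrier_vec m" using K1 x unfolding u_def by auto
  define y where "y = A *\<^sub>v x + B *\<^sub>v u"
  have y: "y \<in> carrier_vec d" using A B x u unfolding y_def by auto
  let ?v1 = "y \<bullet> (P1 *\<^sub>v y)" and ?v2 = "y \<bullet> (P2 *\<^sub>v y)"
  let ?q = "x \<bullet> (Q *\<^sub>v x)" and ?r = "u \<bullet> (R *\<^sub>v u)"
  have e1: "x \<bullet> (P1 *\<^sub>v x) = ?q + ?r + ?v1"
    using riccati_eq_feedback_cost[OF ric1 x] unfolding u_def[symmetric] y_def .
  have e2: "x \<bullet> (P2 *\<^sub>v x) \<le> ?q + ?r + ?v2"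
    using riccati_le_step_cost[OF ric2 x u] unfolding y_def .
  have qr: "0 \<le> ?q" "0 \<le> ?r"
    using Q_psd Q x pos_def_form_nonneg[OF R_pos R u] unfolding pos_semidef_def by auto
  have e3: "?v2 \<le> \<rho> * ?v1" by (rule bound[OF y])
  have "\<rho> * (?q + ?r) + \<rho> * ?v1 \<le> (?q + ?r) + ?v2"
    using e2 unfolding att e1 by (simp add: algebra_simps)
  then have "(\<rho> - 1) * (?q + ?r) \<le> ?v2 - \<rho> * ?v1" by (simp add: algebra_simps)
  moreover have "0 \<le> (\<rho> - 1) * (?q + ?r)" using qr \<rho> by simp
  ultimately have z: "(\<rho> - 1) * (?q + ?r) = 0" and v: "?v2 = \<rho> * ?v1" using e3 by linarith+
  then have "?q + ?r = 0" using \<rho> by simp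
  then have "?q = 0" "?r = 0" using qr by linarith+
  then show "?q = 0" by simp
  have "u = 0\<^sub>v m" by (rule pos_def_form_eq_0D[OF R_pos R u \<open>?r = 0\<close>])
  then have "y = A *\<^sub>v x" using A x mult_mat_vec_zero[OF B] unfolding y_def by simp
  then show "(A *\<^sub>v x) \<bullet> (P2 *\<^sub>v (A *\<^sub>v x)) = \<rho> * ((A *\<^sub>v x) \<bullet> (P1 *\<^sub>v (A *\<^sub>v x)))" using v by simp
qed

text \<open>Compare the two solutions at a vector \<open>z\<close> of maximal ratio \<open>\<rho>\<close>. If \<open>\<rho> > 1\<close>, then the preceding
  lemma applies along the whole unforced orbit of \<open>z\<close>, so the output of that orbit is identically zero and
  observability forces \<open>z = 0\<close>.\<close>

lemma riccati_form_le:
  assumes ric1: "riccati P1 K1" and ric2: "riccati P2 K2"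
    and S: "psd_sqrt Q S" and obs: "observable A S" and x: "x \<in> carrier_vec d"
  shows "x \<bullet> (P2 *\<^sub>v x) \<le> x \<bullet> (P1 *\<^sub>v x)"
proof (cases "d = 0")
  case True
  then show ?thesis using x ric1 ric2 unfolding riccati_def by (auto simp: scalar_prod_def)
next
  case False
  have P1: "P1 \<in> carrier_mat d d" "pos_def P1" and P2: "P2 \<in> carrier_mat d d"
    using ric1 ric2 unfolding riccati_def by auto
  have Sc: "S \<in> carrier_mat d d" and S_sym: "transpose_mat S = S" and SS: "S * S = Q"
    using S Q unfolding psd_sqrt_def by auto
  obtain \<rho> z where z: "z \<in> carrier_vec d" "z \<noteq> 0\<^sub>v d" and att: "z \<bullet> (P2 *\<^sub>v z) = \<rho> * (z \<bullet> (P1 *\<^sub>v z))"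
    and bound: "\<And>y. y \<in> carrier_vec d \<Longrightarrow> y \<bullet> (P2 *\<^sub>v y) \<le> \<rho> * (y \<bullet> (P1 *\<^sub>v y))"
    using form_ratio_attains_max[OF _ P2 P1] False by blast
  have "\<rho> \<le> 1"
  proof (rule ccontr)
    assume "\<not> \<rho> \<le> 1"
    then have \<rho>: "\<rho> > 1" by simp
    note orbit = riccati_excess_orbit[OF ric1 ric2 \<rho> bound]
    have Ak: "A ^\<^sub>m k \<in> carrier_mat d d" for k using A by simp
    define y where "y k = (A ^\<^sub>m k) *\<^sub>v z" for k
    have y: "y k \<in> carrier_vec d" for k using Ak[of k] z unfolding y_def by auto
    \<comment> \<open>General in the starting vector, because \<open>A ^\<^sub>m Suc k\<close> applies \<open>A\<close> to the vector first.\<close>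
    have "((A ^\<^sub>m k) *\<^sub>v w) \<bullet> (P2 *\<^sub>v ((A ^\<^sub>m k) *\<^sub>v w)) = \<rho> * (((A ^\<^sub>m k) *\<^sub>v w) \<bullet> (P1 *\<^sub>v ((A ^\<^sub>m k) *\<^sub>v w)))"
      if "w \<in> carrier_vec d" "w \<bullet> (P2 *\<^sub>v w) = \<rho> * (w \<bullet> (P1 *\<^sub>v w))" for k w
      using that
    proof (induction k arbitrary: w)
      case 0
      then show ?case using A by simp
    next
      case (Suc k)
      have "(A ^\<^sub>m Suc k) *\<^sub>v w = (A ^\<^sub>m k) *\<^sub>v (A *\<^sub>v w)"
        using assoc_mult_mat_vec[OF Ak A Suc.prems(1)] by simp
      then show ?case using Suc.IH[OF _ orbit(2)[OF _ Suc.prems]] Suc.prems(1) A by simp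
    qed
    then have "y k \<bullet> (P2 *\<^sub>v y k) = \<rho> * (y k \<bullet> (P1 *\<^sub>v y k))" for k
      unfolding y_def using z(1) att by blast
    then have Q0: "y k \<bullet> (Q *\<^sub>v y k) = 0" for k by (intro orbit(1)[OF _ y])
    have "S *\<^sub>v y k = 0\<^sub>v d" for k
    proof -
      have c: "S *\<^sub>v y k \<in> carrier_vec d" using Sc y by auto
      have "(S *\<^sub>v y k) \<bullet> (S *\<^sub>v y k) = y k \<bullet> (S *\<^sub>v (S *\<^sub>v y k))"
        using transpose_vec_mult_scalar[OF Sc c y] S_sym by simp
      also have "\<dots> = 0" using Q0 assoc_mult_mat_vec[OF Sc Sc y] SS by metis
      finally have "(S *\<^sub>v y k) \<bullet>c (S *\<^sub>v y k) = 0" by simp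
      then show ?thesis using conjugate_square_eq_0_vec[OF c] by simp
    qed
    then have "\<forall>k. S *\<^sub>v ((A ^\<^sub>m k) *\<^sub>v z) = S *\<^sub>v ((A ^\<^sub>m k) *\<^sub>v 0\<^sub>v d)"
      using Ak Sc mult_mat_vec_zero[OF Ak] mult_mat_vec_zero[OF Sc] unfolding y_def by simp
    then have "z = 0\<^sub>v d" using obs z A unfolding observable_def by auto
    then show False using z by simp
  qed
  then have "\<rho> * (x \<bullet> (P1 *\<^sub>v x)) \<le> 1 * (x \<bullet> (P1 *\<^sub>v x))"
    using pos_def_form_nonneg[OF P1(2,1) x] by (intro mult_right_mono)
  then show ?thesis using bound[OF x] by simp
qed

lemma riccati_unique:
  assumes ric1: "riccati P1 K1" and ric2: "riccati P2 K2"
    and S: "psd_sqrt Q S" "observable A S"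
  shows "P1 = P2"
proof (rule symmetric_mat_eqI)
  show "x \<bullet> (P1 *\<^sub>v x) = x \<bullet> (P2 *\<^sub>v x)" if "x \<in> carrier_vec d" for x
    using riccati_form_le[OF ric1 ric2 S that] riccati_form_le[OF ric2 ric1 S that] by simp
qed (use ric1 ric2 in \<open>auto simp: riccati_def\<close>)

end

section \<open>Permuting rows and columns of matrices\<close>

text \<open>For permutations \<open>\<alpha>\<close> and \<open>\<beta>\<close> of the index ranges this is \<open>\<Pi>\<^sub>\<alpha> M \<Pi>\<^sub>\<beta>\<^sup>T\<close> with permutation matrices
  \<open>\<Pi>\<^sub>\<alpha>\<close> and \<open>\<Pi>\<^sub>\<beta>\<close>. As these are orthogonal, the operation commutes with sums, products and transposes.\<close>

definition permute_mat :: "(nat \<Rightarrow> nat) \<Rightarrow> (nat \<Rightarrow> nat) \<Rightarrow> 'a mat \<Rightarrow> 'a mat" where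
  "permute_mat \<alpha> \<beta> M = mat (dim_row M) (dim_col M) (\<lambda>(i, j). M $$ (\<alpha> i, \<beta> j))"

abbreviation index_perm :: "nat \<Rightarrow> (nat \<Rightarrow> nat) \<Rightarrow> bool" where
  "index_perm N \<alpha> \<equiv> bij_betw \<alpha> {0..<N} {0..<N}"

lemma index_perm_less: "index_perm N \<alpha> \<Longrightarrow> i < N \<Longrightarrow> \<alpha> i < N"
  using bij_betw_apply[of \<alpha> "{0..<N}" "{0..<N}" i] by simp

lemma dim_permute_mat [simp]:
  "dim_row (permute_mat \<alpha> \<beta> M) = dim_row M" "dim_col (permute_mat \<alpha> \<beta> M) = dim_col M"
  by (simp_all add: permute_mat_def)

lemma permute_mat_carrier [simp]: "permute_mat \<alpha> \<beta> M \<in> carrier_mat a b \<longleftrightarrow> M \<in> carrier_mat a b"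
  unfolding carrier_mat_def by simp

lemma permute_mat_add:
  assumes "M \<in> carrier_mat a b" "N \<in> carrier_mat a b" "index_perm a \<alpha>" "index_perm b \<beta>"
  shows "permute_mat \<alpha> \<beta> (M + N) = permute_mat \<alpha> \<beta> M + permute_mat \<alpha> \<beta> N"
  using assms by (intro eq_matI) (auto simp: permute_mat_def index_perm_less)

lemma permute_mat_minus:
  assumes "M \<in> carrier_mat a b" "N \<in> carrier_mat a b" "index_perm a \<alpha>" "index_perm b \<beta>"
  shows "permute_mat \<alpha> \<beta> (M - N) = permute_mat \<alpha> \<beta> M - permute_mat \<alpha> \<beta> N"
  using assms by (intro eq_matI) (auto simp: permute_mat_def index_perm_less)

lemma permute_mat_transpose:
  assumes "M \<in> carrier_mat a b" "index_perm a \<alpha>" "index_perm b \<beta>"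
  shows "permute_mat \<beta> \<alpha> (transpose_mat M) = transpose_mat (permute_mat \<alpha> \<beta> M)"
  using assms by (intro eq_matI) (auto simp: permute_mat_def index_perm_less)

lemma permute_mat_mult:
  assumes M: "M \<in> carrier_mat a b" and N: "N \<in> carrier_mat b c"
    and \<alpha>: "index_perm a \<alpha>" and \<beta>: "index_perm b \<beta>" and \<gamma>: "index_perm c \<gamma>"
  shows "permute_mat \<alpha> \<gamma> (M * N) = permute_mat \<alpha> \<beta> M * permute_mat \<beta> \<gamma> N"
proof (rule eq_matI)
  fix i j assume ij: "i < dim_row (permute_mat \<alpha> \<beta> M * permute_mat \<beta> \<gamma> N)"
    "j < dim_col (permute_mat \<alpha> \<beta> M * permute_mat \<beta> \<gamma> N)"
  then have ij: "i < a" "j < c" "\<alpha> i < a" "\<gamma> j < c"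
    using M N \<alpha> \<gamma> by (auto simp: permute_mat_def index_perm_less)
  have "permute_mat \<alpha> \<gamma> (M * N) $$ (i, j) = (\<Sum>k\<in>{0..<b}. M $$ (\<alpha> i, k) * N $$ (k, \<gamma> j))"
    using M N ij by (simp add: permute_mat_def scalar_prod_def)
  also have "\<dots> = (\<Sum>k\<in>{0..<b}. M $$ (\<alpha> i, \<beta> k) * N $$ (\<beta> k, \<gamma> j))"
    by (rule sum.reindex_bij_betw[OF \<beta>, symmetric])
  also have "\<dots> = (permute_mat \<alpha> \<beta> M * permute_mat \<beta> \<gamma> N) $$ (i, j)"
    using M N ij by (simp add: permute_mat_def scalar_prod_def)
  finally show "permute_mat \<alpha> \<gamma> (M * N) $$ (i, j) = (permute_mat \<alpha> \<beta> M * permute_mat \<beta> \<gamma> N) $$ (i, j)" .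
qed (auto simp: permute_mat_def)

lemma permute_mat_pow:
  assumes M: "M \<in> carrier_mat a a" and \<alpha>: "index_perm a \<alpha>" and inv: "permute_mat \<alpha> \<alpha> M = M"
  shows "permute_mat \<alpha> \<alpha> (M ^\<^sub>m k) = M ^\<^sub>m k"
proof (induction k)
  case 0
  have "\<alpha> i = \<alpha> j \<longleftrightarrow> i = j" if "i < a" "j < a" for i j
    using \<alpha> that by (auto simp: bij_betw_def inj_on_def)
  then show ?case
    using M \<alpha> by (intro eq_matI) (auto simp: permute_mat_def index_perm_less)
next
  case (Suc k)
  then show ?case using permute_mat_mult[OF _ M \<alpha> \<alpha> \<alpha>, of "M ^\<^sub>m k"] M inv by simp
qed

text \<open>The value of the permuted form at \<open>x\<close> is that of the original form at \<open>x\<close> with its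
  coordinates permuted back.\<close>

lemma permute_mat_pos_def:
  assumes M: "M \<in> carrier_mat a a" "pos_def M" and \<alpha>: "index_perm a \<alpha>"
  shows "pos_def (permute_mat \<alpha> \<alpha> M)"
  unfolding pos_def_def
proof (intro ballI impI)
  fix x :: "real vec"
  assume "x \<in> carrier_vec (dim_col (permute_mat \<alpha> \<alpha> M))" "x \<noteq> 0\<^sub>v (dim_col (permute_mat \<alpha> \<alpha> M))"
  then have x: "x \<in> carrier_vec a" "x \<noteq> 0\<^sub>v a" using M by (auto simp: permute_mat_def)
  define \<beta> where "\<beta> = the_inv_into {0..<a} \<alpha>"
  define y where "y = vec a (\<lambda>i. x $ \<beta> i)"
  have yx: "y $ \<alpha> i = x $ i" if "i < a" for i
    using \<alpha> that unfolding y_def \<beta>_def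
    by (simp add: index_perm_less the_inv_into_f_f bij_betw_imp_inj_on)
  obtain i where "i < a" "x $ i \<noteq> 0" using x by (metis carrier_vecD eq_vecI index_zero_vec)
  then have "y \<noteq> 0\<^sub>v a" using yx[of i] index_perm_less[OF \<alpha>] by auto
  moreover have "y \<in> carrier_vec a" unfolding y_def by simp
  ultimately have "0 < y \<bullet> (M *\<^sub>v y)" using M unfolding pos_def_def by auto
  also have "y \<bullet> (M *\<^sub>v y) = (\<Sum>i\<in>{0..<a}. y $ i * (\<Sum>j\<in>{0..<a}. M $$ (i, j) * y $ j))"
    using M \<open>y \<in> carrier_vec a\<close> by (simp add: scalar_prod_def)
  also have "\<dots> = (\<Sum>i\<in>{0..<a}. y $ \<alpha> i * (\<Sum>j\<in>{0..<a}. M $$ (\<alpha> i, j) * y $ j))"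
    by (rule sum.reindex_bij_betw[OF \<alpha>, symmetric])
  also have "\<dots> = (\<Sum>i\<in>{0..<a}. y $ \<alpha> i * (\<Sum>j\<in>{0..<a}. M $$ (\<alpha> i, \<alpha> j) * y $ \<alpha> j))"
    by (intro sum.cong refl arg_cong2[where f = "(*)"] sum.reindex_bij_betw[OF \<alpha>, symmetric])
  also have "\<dots> = x \<bullet> (permute_mat \<alpha> \<alpha> M *\<^sub>v x)"
    using M x by (simp add: scalar_prod_def permute_mat_def yx)
  finally show "0 < x \<bullet> (permute_mat \<alpha> \<alpha> M *\<^sub>v x)" .
qed

context lq_problem begin
text \<open>The permutation commutes with every operation in the two equations and leaves the problem data
  unchanged, so it only replaces the unknowns.\<close>

lemma riccati_permute:
  assumes \<sigma>: "index_perm d \<sigma>" and \<tau>: "index_perm m \<tau>"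
    and inv: "permute_mat \<sigma> \<sigma> A = A" "permute_mat \<sigma> \<tau> B = B" "permute_mat \<sigma> \<sigma> Q = Q" "permute_mat \<tau> \<tau> R = R"
    and ric: "riccati P K"
  shows "riccati (permute_mat \<sigma> \<sigma> P) (permute_mat \<tau> \<sigma> K)"
proof -
  have P: "P \<in> carrier_mat d d" "transpose_mat P = P" "pos_def P" and K: "K \<in> carrier_mat m d"
    and gain: "input_weight P * K = transpose_mat B * P * A"
    and eq: "transpose_mat A * P * A - transpose_mat A * P * B * K + Q = P"
    using ric unfolding riccati_def by auto
  have At: "transpose_mat A \<in> carrier_mat d d" and Bt: "transpose_mat B \<in> carrier_mat m d"
    using A B by auto
  note AtP = mult_carrier_mat[OF At P(1)] and BtP = mult_carrier_mat[OF Bt P(1)]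
  note AtPA = mult_carrier_mat[OF AtP A] and AtPB = mult_carrier_mat[OF AtP B]
    and BtPA = mult_carrier_mat[OF BtP A] and BtPB = mult_carrier_mat[OF BtP B]
  note AtPBK = mult_carrier_mat[OF AtPB K]
  have inv': "permute_mat \<sigma> \<sigma> (transpose_mat A) = transpose_mat A"
    "permute_mat \<tau> \<sigma> (transpose_mat B) = transpose_mat B"
    "transpose_mat (permute_mat \<sigma> \<sigma> P) = permute_mat \<sigma> \<sigma> P"
    using permute_mat_transpose[OF A \<sigma> \<sigma>] permute_mat_transpose[OF B \<sigma> \<tau>]
      permute_mat_transpose[OF P(1) \<sigma> \<sigma>] inv P(2) by simp_all
  let ?P = "permute_mat \<sigma> \<sigma> P" and ?K = "permute_mat \<tau> \<sigma> K"
  have weight: "permute_mat \<tau> \<tau> (input_weight P) = input_weight ?P"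
    unfolding input_weight_def permute_mat_add[OF BtPB R \<tau> \<tau>] permute_mat_mult[OF BtP B \<tau> \<sigma> \<tau>]
      permute_mat_mult[OF Bt P(1) \<tau> \<sigma> \<sigma>] inv inv' by (rule refl)
  have "input_weight ?P * ?K = transpose_mat B * ?P * A"
    using arg_cong[OF gain, of "permute_mat \<tau> \<sigma>"]
    unfolding permute_mat_mult[OF input_weight_carrier[OF P(1)] K \<tau> \<tau> \<sigma>] weight
      permute_mat_mult[OF BtP A \<tau> \<sigma> \<sigma>] permute_mat_mult[OF Bt P(1) \<tau> \<sigma> \<sigma>] inv inv' .
  moreover have "transpose_mat A * ?P * A - transpose_mat A * ?P * B * ?K + Q = ?P"
    using arg_cong[OF eq, of "permute_mat \<sigma> \<sigma>"]
    unfolding permute_mat_add[OF minus_carrier_mat[OF AtPBK] Q \<sigma> \<sigma>] permute_mat_minus[OF AtPA AtPBK \<sigma> \<sigma>]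
      permute_mat_mult[OF AtP A \<sigma> \<sigma> \<sigma>] permute_mat_mult[OF AtPB K \<sigma> \<tau> \<sigma>]
      permute_mat_mult[OF AtP B \<sigma> \<sigma> \<tau>] permute_mat_mult[OF At P(1) \<sigma> \<sigma> \<sigma>] inv inv' .
  ultimately show ?thesis
    using P K inv'(3) permute_mat_pos_def[OF P(1,3) \<sigma>] unfolding riccati_def by simp
qed
end

section \<open>Block circulance as invariance under a shift\<close>

lemma block_index_less: "k * l + c < N * l" if "k < N" "c < l" for k l c :: nat
proof -
  have "k * l + c < Suc k * l" using that by simp
  also have "\<dots> \<le> N * l" using that by (intro mult_le_mono1) simp
  finally show ?thesis .
qed

text \<open>The cyclic shift by one block of length \<open>p\<close>, carried out separately inside each of the
  consecutive segments of length \<open>n * p\<close>. One function on all of \<open>nat\<close> thus serves vectors with any number of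
  segments, and single segments in particular.\<close>

definition segment_shift :: "nat \<Rightarrow> nat \<Rightarrow> nat \<Rightarrow> nat" where
  "segment_shift n p i = (i div (n * p)) * (n * p) + (i mod (n * p) + p) mod (n * p)"

lemma segment_shift_in_segment:
  assumes "0 < n" "0 < p"
  shows "segment_shift n p i div (n * p) = i div (n * p)"
    and "segment_shift n p i mod (n * p) = (i mod (n * p) + p) mod (n * p)"
  using assms by (simp_all add: segment_shift_def)

lemma segment_shift_block:
  assumes "0 < n" "0 < p" "i < n * p"
  shows "segment_shift n p i div p = Suc (i div p) mod n"
    and "segment_shift n p i mod p = i mod p"
proof -
  have "segment_shift n p i = (i + p) mod (p * n)"
    using assms by (simp add: segment_shift_def mult.commute)
  also have "\<dots> = p * ((i + p) div p mod n) + (i + p) mod p" by (rule mod_mult2_eq)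
  also have "\<dots> = p * (Suc (i div p) mod n) + i mod p" using assms by simp
  finally have *: "segment_shift n p i = p * (Suc (i div p) mod n) + i mod p" .
  show "segment_shift n p i div p = Suc (i div p) mod n" "segment_shift n p i mod p = i mod p"
    unfolding * using assms by simp_all
qed

text \<open>Super-segments made of \<open>N\<close> segments each are also mapped to themselves. This is needed for the output
  matrix, whose rows consist of several segments for each time step.\<close>

lemma segment_shift_coarse:
  assumes n: "0 < n" and p: "0 < p"
  shows "segment_shift n p i div (N * (n * p)) = i div (N * (n * p))"
    and "segment_shift n p i mod (N * (n * p)) = segment_shift n p (i mod (N * (n * p)))"
proof -
  let ?l = "n * p"
  show "segment_shift n p i div (N * ?l) = i div (N * ?l)"
    using segment_shift_in_segment(1)[OF n p, of i] div_mult2_eq[of _ ?l N] by (simp add: mult.commute)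
  have m: "j mod (N * ?l) = ?l * (j div ?l mod N) + j mod ?l" for j
    using mod_mult2_eq[of j ?l N] by (simp add: mult.commute)
  show "segment_shift n p i mod (N * ?l) = segment_shift n p (i mod (N * ?l))"
    unfolding m[of "segment_shift n p i"] segment_shift_in_segment[OF n p]
    using n p unfolding m[of i] by (simp add: segment_shift_def)
qed

lemma segment_shift_perm:
  assumes n: "0 < n" and p: "0 < p"
  shows "index_perm (N * (n * p)) (segment_shift n p)"
proof -
  let ?l = "n * p"
  let ?I = "{0..<N * ?l}"
  have "inj_on (segment_shift n p) ?I"
  proof (rule inj_onI)
    fix i j assume eq: "segment_shift n p i = segment_shift n p j"
    have d: "i div ?l = j div ?l" using eq segment_shift_in_segment(1)[OF n p] by metis
    have "[i mod ?l + p = j mod ?l + p] (mod ?l)"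
      using eq segment_shift_in_segment(2)[OF n p] unfolding cong_def by metis
    then have "i mod ?l = j mod ?l" by (simp add: cong_add_rcancel_nat) (simp add: cong_def)
    with d show "i = j" by (metis div_mult_mod_eq)
  qed
  moreover have "segment_shift n p ` ?I \<subseteq> ?I"
  proof
    fix j assume "j \<in> segment_shift n p ` ?I"
    then obtain i where i: "i < N * ?l" "j = segment_shift n p i" by auto
    then have "j div ?l < N" using segment_shift_in_segment(1)[OF n p] n p
      by (simp add: less_mult_imp_div_less)
    then show "j \<in> ?I" using n p by (simp add: div_less_iff_less_mult)
  qed
  ultimately show ?thesis by (simp add: bij_betw_def endo_inj_surj)
qed

definition shift_invariant :: "nat \<Rightarrow> nat \<Rightarrow> nat \<Rightarrow> 'a mat \<Rightarrow> bool" where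
  "shift_invariant n p m M \<longleftrightarrow> permute_mat (segment_shift n p) (segment_shift n m) M = M"

lemma shift_invariant_iff:
  "shift_invariant n p m M \<longleftrightarrow>
     (\<forall>i<dim_row M. \<forall>j<dim_col M. M $$ (segment_shift n p i, segment_shift n m j) = M $$ (i, j))"
  unfolding shift_invariant_def by (auto simp: permute_mat_def mat_eq_iff)

text \<open>This turns block circulance into a symmetry. The shift advances the block row and the block
  column by one, which preserves their difference modulo \<open>n\<close>. Conversely, an invariant matrix is
  determined by its first block row, from which the shift produces all the others.\<close>

lemma block_circulant_iff_shift_invariant:
  assumes n: "0 < n" and p: "0 < p" and m: "0 < m"
  shows "M \<in> block_circulant n p m \<longleftrightarrow> M \<in> carrier_mat (n * p) (n * m) \<and> shift_invariant n p m M"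
    (is "?L \<longleftrightarrow> ?R")
proof
  assume ?L
  then obtain b where M: "M = block_mat n n p m (\<lambda>r s. b (nat ((int s - int r) mod int n)))"
    unfolding block_circulant_def by auto
  have entry: "M $$ (i, j) = b (nat ((int (j div m) - int (i div p)) mod int n)) $$ (i mod p, j mod m)"
    if "i < n * p" "j < n * m" for i j
    using that unfolding M block_mat_def by simp
  have "M $$ (segment_shift n p i, segment_shift n m j) = M $$ (i, j)" if ij: "i < n * p" "j < n * m" for i j
  proof -
    have lt: "segment_shift n p i < n * p" "segment_shift n m j < n * m"
      using index_perm_less[OF segment_shift_perm[OF n p, of 1]] index_perm_less[OF segment_shift_perm[OF n m, of 1]] ij
      by simp_all
    have "(int (Suc (j div m) mod n) - int (Suc (i div p) mod n)) mod int n
        = (int (j div m) - int (i div p)) mod int n"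
      by (simp add: zmod_int mod_diff_eq)
    then show ?thesis
      unfolding entry[OF lt] entry[OF ij] segment_shift_block[OF n p ij(1)] segment_shift_block[OF n m ij(2)]
      by simp
  qed
  then show ?R unfolding shift_invariant_iff M block_mat_def by simp
next
  assume ?R
  then have M: "M \<in> carrier_mat (n * p) (n * m)"
    and inv: "\<And>i j. i < n * p \<Longrightarrow> j < n * m \<Longrightarrow> M $$ (segment_shift n p i, segment_shift n m j) = M $$ (i, j)"
    unfolding shift_invariant_iff by auto
  \<comment> \<open>The generating blocks are those of the first block row.\<close>
  define b where "b k = mat p m (\<lambda>(a, c). M $$ (a, k * m + c))" for k
  have sh: "segment_shift n l (r * l + c) = (Suc r mod n) * l + c" if "r < n" "c < l" for r l c
  proof -
    have "segment_shift n l (r * l + c) div l = Suc r mod n" "segment_shift n l (r * l + c) mod l = c"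
      using segment_shift_block[OF n _ block_index_less[OF that]] that by simp_all
    then show ?thesis using div_mult_mod_eq[of "segment_shift n l (r * l + c)" l] by simp
  qed
  have shifted: "M $$ (r * p + a, ((k + r) mod n) * m + c) = M $$ (a, k * m + c)"
    if "r < n" "k < n" "a < p" "c < m" for r k a c
    using \<open>r < n\<close>
  proof (induction r)
    case 0
    then show ?case using that by simp
  next
    case (Suc r)
    have "M $$ (Suc r * p + a, ((k + Suc r) mod n) * m + c)
        = M $$ (segment_shift n p (r * p + a), segment_shift n m (((k + r) mod n) * m + c))"
      using Suc.prems that sh[of r a p] sh[of "(k + r) mod n" c m] by (simp add: mod_Suc_eq)
    also have "\<dots> = M $$ (r * p + a, ((k + r) mod n) * m + c)"
      using Suc.prems that n by (intro inv block_index_less) auto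
    finally show ?case using Suc by simp
  qed
  have "M = block_mat n n p m (\<lambda>r s. b (nat ((int s - int r) mod int n)))"
  proof (rule eq_matI)
    fix i j assume "i < dim_row (block_mat n n p m (\<lambda>r s. b (nat ((int s - int r) mod int n))))"
      "j < dim_col (block_mat n n p m (\<lambda>r s. b (nat ((int s - int r) mod int n))))"
    then have ij: "i < n * p" "j < n * m" by (auto simp: block_mat_def)
    define r s k where "r = i div p" and "s = j div m" and "k = nat ((int s - int r) mod int n)"
    have rs: "r < n" "s < n" using ij unfolding r_def s_def by (auto simp: less_mult_imp_div_less)
    have k: "k < n" using n unfolding k_def by (simp add: nat_less_iff)
    have "int ((k + r) mod n) = int s mod int n"
      using n unfolding k_def by (simp add: zmod_int mod_add_left_eq)
    then have ks: "(k + r) mod n = s" using rs by simp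
    have "M $$ (i, j) = M $$ (r * p + i mod p, ((k + r) mod n) * m + j mod m)"
      unfolding ks unfolding r_def s_def by simp
    also have "\<dots> = b k $$ (i mod p, j mod m)"
      using shifted[OF rs(1) k, of "i mod p" "j mod m"] p m by (simp add: b_def)
    finally show "M $$ (i, j) = block_mat n n p m (\<lambda>r s. b (nat ((int s - int r) mod int n))) $$ (i, j)"
      using ij by (simp add: block_mat_def k_def r_def s_def)
  qed (use M in \<open>auto simp: block_mat_def\<close>)
  then show ?L unfolding block_circulant_def b_def by (auto intro!: exI[of _ b] simp: b_def)
qed

section \<open>Shift invariance of matrices with several segments\<close>

locale shift_order =
  fixes n :: nat assumes n: "0 < n"
begin

lemma shift_invariant_add:
  assumes "0 < p" "0 < m" and MN: "M \<in> carrier_mat (a * (n * p)) (b * (n * m))" "N \<in> carrier_mat (a * (n * p)) (b * (n * m))"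
    and "shift_invariant n p m M" "shift_invariant n p m N"
  shows "shift_invariant n p m (M + N)"
  using permute_mat_add[OF MN segment_shift_perm[OF n] segment_shift_perm[OF n]] assms
  unfolding shift_invariant_def by simp

lemma shift_invariant_transpose:
  assumes "0 < p" "0 < m" and M: "M \<in> carrier_mat (a * (n * p)) (b * (n * m))"
    and "shift_invariant n p m M"
  shows "shift_invariant n m p (transpose_mat M)"
  using permute_mat_transpose[OF M segment_shift_perm[OF n] segment_shift_perm[OF n]] assms
  unfolding shift_invariant_def by simp

lemma shift_invariant_mult:
  assumes "0 < p" "0 < m" "0 < l" and M: "M \<in> carrier_mat (a * (n * p)) (b * (n * m))"
    and N: "N \<in> carrier_mat (b * (n * m)) (c * (n * l))"
    and "shift_invariant n p m M" "shift_invariant n m l N"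
  shows "shift_invariant n p l (M * N)"
  using permute_mat_mult[OF M N segment_shift_perm[OF n] segment_shift_perm[OF n] segment_shift_perm[OF n]] assms
  unfolding shift_invariant_def by simp

lemma shift_invariant_pow:
  assumes "0 < p" and M: "M \<in> carrier_mat (a * (n * p)) (a * (n * p))" and "shift_invariant n p p M"
  shows "shift_invariant n p p (M ^\<^sub>m k)"
  using permute_mat_pow[OF M segment_shift_perm[OF n]] assms unfolding shift_invariant_def by simp

lemma segment_shift_less:
  assumes "0 < p"
  shows "segment_shift n p i < N * (n * p) \<longleftrightarrow> i < N * (n * p)"
proof -
  have "i < N * (n * p) \<longleftrightarrow> i div (n * p) < N" for i
    using n assms by (simp add: div_less_iff_less_mult)
  then show ?thesis using segment_shift_in_segment(1)[OF n assms] by simp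
qed

lemma segment_shift_add:
  assumes "0 < p"
  shows "segment_shift n p (N * (n * p) + i) = N * (n * p) + segment_shift n p i"
  using n assms by (simp add: segment_shift_def add_mult_distrib)

lemma shift_invariant_zero:
  assumes "0 < p" "0 < m"
  shows "shift_invariant n p m (0\<^sub>m (a * (n * p)) (b * (n * m)))"
  unfolding shift_invariant_iff using assms by (simp add: segment_shift_less)

lemma shift_invariant_smult:
  assumes "0 < p" "0 < m" "M \<in> carrier_mat (a * (n * p)) (b * (n * m))" "shift_invariant n p m M"
  shows "shift_invariant n p m (c \<cdot>\<^sub>m M)"
  using assms unfolding shift_invariant_iff by (simp add: segment_shift_less)

lemma shift_invariant_block_mat:
  assumes p: "0 < p" and m: "0 < m"
    and F: "\<And>r s. r < br \<Longrightarrow> s < bc \<Longrightarrow> F r s \<in> carrier_mat (a * (n * p)) (b * (n * m)) \<and> shift_invariant n p m (F r s)"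
  shows "shift_invariant n p m (block_mat br bc (a * (n * p)) (b * (n * m)) F)"
proof -
  let ?a = "a * (n * p)" and ?b = "b * (n * m)"
  have "block_mat br bc ?a ?b F $$ (segment_shift n p i, segment_shift n m j) = block_mat br bc ?a ?b F $$ (i, j)"
    if i: "i < br * ?a" and j: "j < bc * ?b" for i j
  proof -
    have s: "segment_shift n p i < br * ?a" "segment_shift n m j < bc * ?b"
      using i j segment_shift_less[OF p, of i "br * a"] segment_shift_less[OF m, of j "bc * b"]
      by (simp_all add: mult.assoc)
    have pos: "0 < ?a" "0 < ?b" using i j by (auto intro!: Nat.gr0I)
    have "i div ?a < br" "j div ?b < bc" using i j by (simp_all add: less_mult_imp_div_less)
    from F[OF this] have "F (i div ?a) (j div ?b) \<in> carrier_mat ?a ?b"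
      "shift_invariant n p m (F (i div ?a) (j div ?b))" by auto
    then have "F (i div ?a) (j div ?b) $$ (segment_shift n p (i mod ?a), segment_shift n m (j mod ?b))
      = F (i div ?a) (j div ?b) $$ (i mod ?a, j mod ?b)"
      unfolding shift_invariant_iff using pos by auto
    then show ?thesis
      using i j s unfolding block_mat_def
      by (simp add: segment_shift_coarse[OF n p] segment_shift_coarse[OF n m])
  qed
  then show ?thesis unfolding shift_invariant_iff by (simp add: block_mat_def)
qed

lemma shift_invariant_kron_one:
  assumes "0 < p" "0 < m" "M \<in> carrier_mat (a * (n * p)) (b * (n * m))" "shift_invariant n p m M"
  shows "shift_invariant n p m (kron_mat (1\<^sub>m N) M)"
proof -
  have "kron_mat (1\<^sub>m N) M = block_mat N N (a * (n * p)) (b * (n * m)) (\<lambda>r s. 1\<^sub>m N $$ (r, s) \<cdot>\<^sub>m M)"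
    using assms(3) unfolding kron_mat_def by simp
  moreover have "shift_invariant n p m \<dots>"
    by (rule shift_invariant_block_mat[OF assms(1,2)]) (use shift_invariant_smult[OF assms] assms(3) in simp)
  ultimately show ?thesis by simp
qed

text \<open>A row or column index keeps its side of the cut, as the cut lies between two segments.\<close>

lemma shift_invariant_four_block:
  assumes p: "0 < p" and m: "0 < m"
    and c: "A \<in> carrier_mat (a * (n * p)) (b * (n * m))" "B \<in> carrier_mat (a * (n * p)) (b' * (n * m))"
      "C \<in> carrier_mat (a' * (n * p)) (b * (n * m))" "D \<in> carrier_mat (a' * (n * p)) (b' * (n * m))"
    and inv: "shift_invariant n p m A" "shift_invariant n p m B" "shift_invariant n p m C" "shift_invariant n p m D"
  shows "shift_invariant n p m (four_block_mat A B C D)"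
  unfolding shift_invariant_iff
proof (intro allI impI)
  let ?a = "a * (n * p)" and ?b = "b * (n * m)"
  fix i j assume "i < dim_row (four_block_mat A B C D)" "j < dim_col (four_block_mat A B C D)"
  then have ij: "i < ?a + a' * (n * p)" "j < ?b + b' * (n * m)" using c by auto
  have s: "segment_shift n p i < ?a + a' * (n * p)" "segment_shift n m j < ?b + b' * (n * m)"
    using ij segment_shift_less[OF p, of i "a + a'"] segment_shift_less[OF m, of j "b + b'"]
    by (simp_all add: add_mult_distrib)
  have sub: "segment_shift n p i - ?a = segment_shift n p (i - ?a)" if "\<not> i < ?a"
    using segment_shift_add[OF p, of a "i - ?a"] that by simp
  have sub': "segment_shift n m j - ?b = segment_shift n m (j - ?b)" if "\<not> j < ?b"
    using segment_shift_add[OF m, of b "j - ?b"] that by simp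
  show "four_block_mat A B C D $$ (segment_shift n p i, segment_shift n m j) = four_block_mat A B C D $$ (i, j)"
    using ij s c inv unfolding shift_invariant_iff
    by (simp add: segment_shift_less[OF p] segment_shift_less[OF m] sub sub')
qed

lemma segment_replicate: "k < N \<Longrightarrow> segment n (replicate N l) k = {k * (n * l)..<k * (n * l) + n * l}"
  unfolding segment_def by (simp add: sum_list_replicate algebra_simps)

lemma pick_interval:
  assumes "i < l" shows "pick {a..<a + l} i = a + i"
proof -
  have "{x \<in> {a..<a + l}. x < a + i} = {a..<a + i}" using assms by auto
  then show ?thesis using pick_card_in_set[of "a + i" "{a..<a + l}"] assms by simp
qed

lemma segment_within:
  assumes "k < N" shows "{i. i < N * (n * l) \<and> i \<in> segment n (replicate N l) k} = {k * (n * l)..<k * (n * l) + n * l}"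
proof -
  have "k * (n * l) + n * l \<le> N * (n * l)"
    using mult_le_mono1[of "Suc k" N "n * l"] assms by simp
  then show ?thesis unfolding segment_replicate[OF assms] by auto
qed

lemma card_segment_within:
  assumes "k < N" shows "card {i. i < N * (n * l) \<and> i \<in> segment n (replicate N l) k} = n * l"
  unfolding segment_within[OF assms] by simp

lemma pick_segment:
  assumes "k < N" "i < n * l" shows "pick (segment n (replicate N l) k) i = k * (n * l) + i"
  unfolding segment_replicate[OF assms(1)] using assms(2) by (rule pick_interval)

text \<open>The shift of the whole matrix maps each pair of segments to itself, so it restricts to the
  submatrix as the shift of a single segment in both directions.\<close>

lemma submatrix_segment_block_circulant:
  assumes p: "0 < p" and m: "0 < m" and M: "M \<in> carrier_mat (N * (n * p)) (L * (n * m))"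
    and inv: "shift_invariant n p m M" and k: "k < N" and j: "j < L"
  shows "submatrix M (segment n (replicate N p) k) (segment n (replicate L m) j) \<in> block_circulant n p m"
proof -
  have "submatrix M (segment n (replicate N p) k) (segment n (replicate L m) j)
      = mat (n * p) (n * m) (\<lambda>(i, c). M $$ (k * (n * p) + i, j * (n * m) + c))"
    unfolding submatrix_def carrier_matD[OF M] card_segment_within[OF k] card_segment_within[OF j]
    by (rule cong_mat) (simp_all add: pick_segment[OF k] pick_segment[OF j])
  moreover have "shift_invariant n p m \<dots>"
    unfolding shift_invariant_iff
  proof (intro allI impI, goal_cases)
    case (1 i c)
    then have ic: "i < n * p" "c < n * m" by auto
    have "k * (n * p) + i < N * (n * p)" "j * (n * m) + c < L * (n * m)"
      by (rule block_index_less[OF k ic(1)], rule block_index_less[OF j ic(2)])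
    then have "M $$ (segment_shift n p (k * (n * p) + i), segment_shift n m (j * (n * m) + c)) = M $$ (k * (n * p) + i, j * (n * m) + c)"
      using inv M unfolding shift_invariant_iff by auto
    then show ?case
      using ic segment_shift_less[OF p, of i 1] segment_shift_less[OF m, of c 1]
      by (simp add: segment_shift_add[OF p] segment_shift_add[OF m])
  qed
  ultimately show ?thesis using block_circulant_iff_shift_invariant[OF n p m] by simp
qed

text \<open>The converse direction for one block column, in the form in which \<open>C\<close> and \<open>D\<close> are given.\<close>

lemma shift_invariant_stack:
  assumes p: "0 < p" and m: "0 < m" and M: "M \<in> carrier_mat (N * (n * p)) (n * m)"
    and blocks: "\<And>k. k < N \<Longrightarrow> submatrix M (segment n (replicate N p) k) UNIV \<in> block_circulant n p m"
  shows "shift_invariant n p m M"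
  unfolding shift_invariant_iff
proof (intro allI impI)
  fix i j assume "i < dim_row M" "j < dim_col M"
  then have ij: "i < N * (n * p)" "j < n * m" using M by auto
  define k i' where "k = i div (n * p)" and "i' = i mod (n * p)"
  have i: "i = k * (n * p) + i'" unfolding k_def i'_def by (rule div_mult_mod_eq[symmetric])
  have k: "k < N" using ij(1) unfolding k_def by (simp add: less_mult_imp_div_less)
  have i': "i' < n * p" using n p unfolding i'_def by simp
  let ?S = "submatrix M (segment n (replicate N p) k) UNIV"
  have S: "?S = mat (n * p) (n * m) (\<lambda>(a, c). M $$ (k * (n * p) + a, c))"
    unfolding submatrix_def carrier_matD[OF M] card_segment_within[OF k]
    by (rule cong_mat) (simp_all add: pick_segment[OF k] pick_UNIV)
  have "shift_invariant n p m ?S"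
    using blocks[OF k] block_circulant_iff_shift_invariant[OF n p m] by simp
  then have "?S $$ (segment_shift n p i', segment_shift n m j) = ?S $$ (i', j)"
    using i' ij unfolding shift_invariant_iff S by simp
  then show "M $$ (segment_shift n p i, segment_shift n m j) = M $$ (i, j)"
    using i' ij segment_shift_less[OF p, of i' 1] segment_shift_less[OF m, of j 1]
    unfolding S i segment_shift_add[OF p] by simp
qed
end

lemma block_mat_carrier [simp]: "block_mat br bc p m F \<in> carrier_mat (br * p) (bc * m)"
  by (simp add: block_mat_def)

lemma kron_one_carrier:
  assumes "M \<in> carrier_mat a b" shows "kron_mat (1\<^sub>m N) M \<in> carrier_mat (N * a) (N * b)"
  using assms unfolding kron_mat_def by simp

section \<open>The condensed problem\<close>

text \<open>Only the Riccati equation ties \<open>P\<close> to the circulant data. The shift is a symmetry of \<open>A\<close>, \<open>B\<close>, \<open>Q\<close> and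
  \<open>R\<close>, so the shifted \<open>P\<close> is again a positive definite solution of the Riccati equation, and by
  uniqueness it equals \<open>P\<close>.\<close>

lemma terminal_weight_block_circulant:
  assumes mpc: "block_circulant_MPC n nx nu ny p M" and std: "MPC_standing_assumptions M"
  shows "mpc_P M \<in> block_circulant n nx nx"
proof -
  let ?A = "mpc_A M" and ?B = "mpc_B M" and ?Q = "mpc_Q M" and ?R = "mpc_R M" and ?P = "mpc_P M"
  have pos: "0 < n" "0 < nx" "0 < nu" and P: "?P \<in> carrier_mat (n * nx) (n * nx)"
    and bc: "?A \<in> block_circulant n nx nx" "?B \<in> block_circulant n nx nu"
      "?Q \<in> block_circulant n nx nx" "?R \<in> block_circulant n nu nu"
    using mpc unfolding block_circulant_MPC_def by auto
  note char = block_circulant_iff_shift_invariant[OF pos(1)]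
  have std': "transpose_mat ?R = ?R" "pos_def ?R" "pos_semidef ?Q"
    "transpose_mat ?P = ?P" "pos_def ?P" "solves_DARE ?A ?B ?Q ?R ?P"
    using std unfolding MPC_standing_assumptions_def by auto
  obtain S where S: "psd_sqrt ?Q S" "observable ?A S"
    using std unfolding MPC_standing_assumptions_def by auto
  interpret lq_problem "n * nx" "n * nu" ?A ?B ?Q ?R
    by unfold_locales (use bc std' pos in \<open>auto simp: char\<close>)
  obtain K where K: "riccati ?P K" using DARE_imp_riccati[OF P std'(4-6)] .
  have perm: "index_perm (n * nx) (segment_shift n nx)" "index_perm (n * nu) (segment_shift n nu)"
    using segment_shift_perm[OF pos(1), of _ 1] pos by simp_all
  have "riccati (permute_mat (segment_shift n nx) (segment_shift n nx) ?P)
      (permute_mat (segment_shift n nu) (segment_shift n nx) K)"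
    by (rule riccati_permute[OF perm _ _ _ _ K]) (use bc pos in \<open>simp_all add: char shift_invariant_def\<close>)
  then have "shift_invariant n nx nx ?P"
    unfolding shift_invariant_def by (rule riccati_unique[OF _ K S])
  then show ?thesis using P pos by (simp add: char)
qed

theorem corollary4:
  fixes M :: mpc_data and n nx nu ny p :: nat
  assumes "block_circulant_MPC n nx nu ny p M"
    and "MPC_standing_assumptions M"
  shows "CBCQP n (condensed_QP M) \<and>
    CBCQP_partition n (replicate (mpc_T M) nu) (replicate (mpc_T M * p) ny) (condensed_QP M)"
proof -
  let ?T = "mpc_T M" and ?A = "mpc_A M" and ?B = "mpc_B M" and ?C = "mpc_C M" and ?D = "mpc_D M"
    and ?Q = "mpc_Q M" and ?R = "mpc_R M" and ?P = "mpc_P M"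
  let ?G = "condensed_G M" and ?H = "condensed_H M" and ?W = "state_weight M" and ?Y = "output_map M"
  have pos: "0 < n" "0 < nx" "0 < nu" "0 < ny" "0 < p" "0 < ?T"
    and bc: "?A \<in> block_circulant n nx nx" "?B \<in> block_circulant n nx nu"
      "?Q \<in> block_circulant n nx nx" "?R \<in> block_circulant n nu nu"
    and C: "?C \<in> carrier_mat (p * (n * ny)) (n * nx)"
      "\<And>i. i < p \<Longrightarrow> submatrix ?C (segment n (replicate p ny) i) UNIV \<in> block_circulant n ny nx"
    and D: "?D \<in> carrier_mat (p * (n * ny)) (n * nu)"
      "\<And>i. i < p \<Longrightarrow> submatrix ?D (segment n (replicate p ny) i) UNIV \<in> block_circulant n ny nu"
    and vecs: "mpc_lo M \<in> carrier_vec (p * (n * ny))" "mpc_hi M \<in> carrier_vec (p * (n * ny))"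
      "mpc_x0 M \<in> carrier_vec (n * nx)"
    using assms(1) unfolding block_circulant_MPC_def by auto
  interpret shift_order n by unfold_locales (rule pos(1))
  note char = block_circulant_iff_shift_invariant[OF pos(1)]
  have A: "?A \<in> carrier_mat (n * nx) (n * nx)" "shift_invariant n nx nx ?A"
    and B: "?B \<in> carrier_mat (n * nx) (n * nu)" "shift_invariant n nx nu ?B"
    and Q: "?Q \<in> carrier_mat (n * nx) (n * nx)" "shift_invariant n nx nx ?Q"
    and R: "?R \<in> carrier_mat (n * nu) (n * nu)" "shift_invariant n nu nu ?R"
    and P: "?P \<in> carrier_mat (n * nx) (n * nx)" "shift_invariant n nx nx ?P"
    using bc terminal_weight_block_circulant[OF assms] pos by (simp_all add: char)
  have Ci: "shift_invariant n ny nx ?C" by (rule shift_invariant_stack[OF pos(4,2) C])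
  have Di: "shift_invariant n ny nu ?D" by (rule shift_invariant_stack[OF pos(4,3) D])

  \<comment> \<open>Every block of \<open>G\<close> is invariant under a single-segment shift, hence \<open>G\<close> under the segment-wise one.\<close>
  have G: "?G \<in> carrier_mat (Suc ?T * (n * nx)) (?T * (n * nu))"
    using B(1) unfolding condensed_G_def by (simp del: mult_Suc)
  have Gi: "shift_invariant n nx nu ?G"
  proof -
    have "shift_invariant n nx nu (?A ^\<^sub>m k * ?B)" for k
      using shift_invariant_mult[OF pos(2,2,3), of "?A ^\<^sub>m k" 1 1 ?B 1]
        shift_invariant_pow[OF pos(2), of ?A 1] A B by simp
    moreover have "?A ^\<^sub>m k * ?B \<in> carrier_mat (n * nx) (n * nu)" for k
      by (rule mult_carrier_mat[OF pow_carrier_mat[OF A(1)] B(1)])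
    moreover have "shift_invariant n nx nu (0\<^sub>m (n * nx) (n * nu) :: real mat)"
      using shift_invariant_zero[OF pos(2,3), of 1 1] by simp
    ultimately have "shift_invariant n nx nu (block_mat (Suc ?T) ?T (1 * (n * nx)) (1 * (n * nu))
        (\<lambda>k j. if j < k then ?A ^\<^sub>m (k - 1 - j) * ?B else 0\<^sub>m (n * nx) (n * nu)))"
      by (intro shift_invariant_block_mat[OF pos(2,3)]) simp
    then show ?thesis unfolding condensed_G_def carrier_matD[OF B(1)] by simp
  qed

  note IQ = kron_one_carrier[OF Q(1), of ?T] and IC = kron_one_carrier[OF C(1), of ?T]
    and IR = kron_one_carrier[OF R(1), of ?T] and ID = kron_one_carrier[OF D(1), of ?T]
  have W_eq: "?W = four_block_mat (kron_mat (1\<^sub>m ?T) ?Q) (0\<^sub>m (?T * (n * nx)) (n * nx))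
      (0\<^sub>m (n * nx) (?T * (n * nx))) ?P"
    using IQ P(1)
    unfolding state_weight_def diag_block_mat.simps(2)[of _ "[?P]"] diag_block_mat_singleton Let_def
    by simp
  have W: "?W \<in> carrier_mat (Suc ?T * (n * nx)) (Suc ?T * (n * nx))"
    unfolding W_eq using four_block_carrier_mat[OF IQ P(1)] by (simp add: add.commute)
  have Wi: "shift_invariant n nx nx ?W"
    unfolding W_eq
    using shift_invariant_four_block[OF pos(2,2), of "kron_mat (1\<^sub>m ?T) ?Q" ?T ?T
        "0\<^sub>m (?T * (n * nx)) (n * nx)" 1 "0\<^sub>m (n * nx) (?T * (n * nx))" 1 ?P]
      IQ P shift_invariant_kron_one[OF pos(2,2), of ?Q 1 1] Q
      shift_invariant_zero[OF pos(2,2), of ?T 1] shift_invariant_zero[OF pos(2,2), of 1 ?T]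
    by simp

  \<comment> \<open>The rows of \<open>I \<otimes> C\<close> form \<open>T\<close> blocks of \<open>p\<close> segments each, that is \<open>T * p\<close> segments.\<close>
  have Y_eq: "?Y = four_block_mat (kron_mat (1\<^sub>m ?T) ?C) (0\<^sub>m (?T * (p * (n * ny))) (n * nx))
      (0\<^sub>m 0 (?T * (n * nx))) (0\<^sub>m 0 (n * nx))"
    using IC C(1) unfolding output_map_def append_columns_def by simp
  have Y: "?Y \<in> carrier_mat (?T * (p * (n * ny))) (Suc ?T * (n * nx))"
    unfolding Y_eq using four_block_carrier_mat[OF IC, of "0\<^sub>m 0 (n * nx)" 0 "n * nx"] by (simp add: add.commute)
  have Yi: "shift_invariant n ny nx ?Y"
    unfolding Y_eq
    using shift_invariant_four_block[OF pos(4,2), of "kron_mat (1\<^sub>m ?T) ?C" "?T * p" ?T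
        "0\<^sub>m (?T * (p * (n * ny))) (n * nx)" 1 "0\<^sub>m 0 (?T * (n * nx))" 0 "0\<^sub>m 0 (n * nx)"]
      IC shift_invariant_kron_one[OF pos(4,2), of ?C p 1] C(1) Ci
      shift_invariant_zero[OF pos(4,2), of "?T * p" 1] shift_invariant_zero[OF pos(4,2), of 0 ?T]
      shift_invariant_zero[OF pos(4,2), of 0 1]
    by (simp add: mult.assoc)

  note Gt = transpose_carrier_mat[THEN iffD2, OF G]
  note GtW = mult_carrier_mat[OF Gt W] and YG = mult_carrier_mat[OF Y G]
  note GtWG = mult_carrier_mat[OF GtW G]
  let ?J = "transpose_mat ?G * ?W * ?G + kron_mat (1\<^sub>m ?T) ?R" and ?K = "?Y * ?G + kron_mat (1\<^sub>m ?T) ?D"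
  have J: "?J \<in> carrier_mat (?T * (n * nu)) (?T * (n * nu))" using GtWG IR by simp
  have K: "?K \<in> carrier_mat ((?T * p) * (n * ny)) (?T * (n * nu))" using YG ID by (simp add: mult.assoc)
  have Ji: "shift_invariant n nu nu ?J"
  proof (rule shift_invariant_add[OF pos(3,3) GtWG IR])
    show "shift_invariant n nu nu (transpose_mat ?G * ?W * ?G)"
      by (rule shift_invariant_mult[OF pos(3,2,3) GtW G shift_invariant_mult[OF pos(3,2,2) Gt W
            shift_invariant_transpose[OF pos(2,3) G Gi] Wi] Gi])
    show "shift_invariant n nu nu (kron_mat (1\<^sub>m ?T) ?R)"
      using shift_invariant_kron_one[OF pos(3,3), of ?R 1 1] R by simp
  qed
  have Ki: "shift_invariant n ny nu ?K"
  proof (rule shift_invariant_add[OF pos(4,3)])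
    show "?Y * ?G \<in> carrier_mat ((?T * p) * (n * ny)) (?T * (n * nu))"
      "kron_mat (1\<^sub>m ?T) ?D \<in> carrier_mat ((?T * p) * (n * ny)) (?T * (n * nu))"
      using YG ID by (simp_all add: mult.assoc)
    show "shift_invariant n ny nu (?Y * ?G)"
      using shift_invariant_mult[OF pos(4,2,3) _ G _ Gi, of ?Y "?T * p"] Y Yi by (simp add: mult.assoc)
    show "shift_invariant n ny nu (kron_mat (1\<^sub>m ?T) ?D)"
      using shift_invariant_kron_one[OF pos(4,3), of ?D p 1] D(1) Di by simp
  qed
  have H: "?H \<in> carrier_mat (Suc ?T * (n * nx)) (n * nx)"
    using A(1) block_mat_carrier[of "Suc ?T" 1 "n * nx" "n * nx"] unfolding condensed_H_def by simp
  have "CBCQP_partition n (replicate ?T nu) (replicate (?T * p) ny) (condensed_QP M)"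
    unfolding CBCQP_partition_def
  proof (intro conjI allI impI)
    note dims = sum_list_replicate mult.commute mult.left_commute
    show "qp_J (condensed_QP M) \<in> carrier_mat (n * sum_list (replicate ?T nu)) (n * sum_list (replicate ?T nu))"
      using J by (simp add: condensed_QP_def Let_def dims)
    show "qp_K (condensed_QP M) \<in> carrier_mat (n * sum_list (replicate (?T * p) ny)) (n * sum_list (replicate ?T nu))"
      using K by (simp add: condensed_QP_def Let_def dims)
    show "qp_q (condensed_QP M) \<in> carrier_vec (n * sum_list (replicate ?T nu))"
      using mult_mat_vec_carrier[OF mult_carrier_mat[OF GtW H] vecs(3)]
      by (simp add: condensed_QP_def Let_def dims)
    have "(?Y * ?H) *\<^sub>v mpc_x0 M \<in> carrier_vec (?T * (p * (n * ny)))"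
      by (rule mult_mat_vec_carrier[OF mult_carrier_mat[OF Y H] vecs(3)])
    then show "qp_lo (condensed_QP M) \<in> carrier_vec (n * sum_list (replicate (?T * p) ny))"
      "qp_hi (condensed_QP M) \<in> carrier_vec (n * sum_list (replicate (?T * p) ny))"
      unfolding carrier_vec_def condensed_QP_def Let_def by (simp_all add: dims)
    fix k j
    assume "k < length (replicate ?T nu)" "j < length (replicate ?T nu)"
    then show "submatrix (qp_J (condensed_QP M)) (segment n (replicate ?T nu) k) (segment n (replicate ?T nu) j)
        \<in> block_circulant n (replicate ?T nu ! k) (replicate ?T nu ! j)"
      using submatrix_segment_block_circulant[OF pos(3,3) J Ji] by (simp add: condensed_QP_def Let_def)
  next
    fix w j
    assume "w < length (replicate (?T * p) ny)" "j < length (replicate ?T nu)"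
    then show "submatrix (qp_K (condensed_QP M)) (segment n (replicate (?T * p) ny) w) (segment n (replicate ?T nu) j)
        \<in> block_circulant n (replicate (?T * p) ny ! w) (replicate ?T nu ! j)"
      using submatrix_segment_block_circulant[OF pos(4,3) K Ki] by (simp add: condensed_QP_def Let_def)
  qed (use pos in auto)
  then show ?thesis using pos(1) unfolding CBCQP_def by blast
qed

end
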